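(* Let $q=p^f$ be a prime power, $N>2$ an integer with $N\mid(q-1)$, $\gamma$ a primitive element of $\mathbb{F}_q$, and $C_0=\langle\gamma^N\rangle$. Let $t$ be the largest power of $p$ dividing $G_q(\chi)$ for all nontrivial multiplicative characters $\chi$ of $\mathbb{F}_q$ trivial on $C_0$. Assume there are positive integers $u,v,r,s$ such that (i) $t(-ur+vs)\equiv -1\pmod N$; (ii) $(N-1)q+t^2(-ur+vs)^2=Nt^2(u^2r+v^2s)$. Let $m=\gcd\{\mathrm{ord}_n(p): n>1,\ n\mid N\}$ and assume $m\ge2$. If one of the following holds: (1) $u=s=1$, $v(v+1)<2m$, and $r+1<N$; (2) $u=s=1$, $v(v+1)=2m$, and $r+v^2<N$; (3) $v=r=1$, $u(u+1)<2m$, and $s+1<N$; (4) $v=r=1$, $u(u+1)=2m$, and $s+u^2<N$; (5) $u=v=1$, $s=m$, and $r+m<N$; (6) $u=v=1$, $r=m$, and $s+m<N$, then the Gauss periods $\eta_a=\sum_{x\in\gamma^aC_0}\psi(x)$, $0\le a\le N-1$, take exactly three values.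
   Context: $\psi$ is the canonical additive character of $\mathbb{F}_q$: $\psi(x)=\xi_p^{\mathrm{Tr}_{q/p}(x)}$. For a multiplicative character $\chi$, $G_q(\chi)=\sum_{a\in\mathbb{F}_q^*}\chi(a)\psi(a)$; divisibility is in the ring of algebraic integers. $\mathrm{ord}_n(p)$ is the multiplicative order of $p$ modulo $n$. *)

theory Defs
  imports "HOL-Analysis.Analysis" "HOL-Number_Theory.Number_Theory"
    "HOL-Computational_Algebra.Polynomial"
begin

definition ff_trace :: "nat \<Rightarrow> nat \<Rightarrow> 'a::field \<Rightarrow> 'a" where
  "ff_trace p f x = (\<Sum>i<f. x ^ (p ^ i))"

text \<open>Canonical additive character psi(x) = xi_p^(Tr(x)), where Tr(x) lies in the
  prime field {of_nat k | k < p} and is identified with the least such k.\<close>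
definition add_char :: "nat \<Rightarrow> nat \<Rightarrow> 'a::field \<Rightarrow> complex" where
  "add_char p f x = cis (2 * pi / real p) ^ (LEAST k. (of_nat k :: 'a) = ff_trace p f x)"

definition mult_char :: "('a::field \<Rightarrow> complex) \<Rightarrow> bool" where
  "mult_char chi \<longleftrightarrow> (\<forall>x y. x \<noteq> 0 \<longrightarrow> y \<noteq> 0 \<longrightarrow> chi (x * y) = chi x * chi y)
                   \<and> (\<forall>x. x \<noteq> 0 \<longrightarrow> chi x \<noteq> 0)"

definition gauss_sum :: "nat \<Rightarrow> nat \<Rightarrow> ('a::{finite,field} \<Rightarrow> complex) \<Rightarrow> complex" where
  "gauss_sum p f chi = (\<Sum>a\<in>{a::'a. a \<noteq> 0}. chi a * add_char p f a)"

definition alg_int_dvd :: "complex \<Rightarrow> complex \<Rightarrow> bool" where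
  "alg_int_dvd a b \<longleftrightarrow> (\<exists>c. algebraic_int c \<and> b = a * c)"

definition primitive_elem :: "'a::{finite,field} \<Rightarrow> bool" where
  "primitive_elem \<gamma> \<longleftrightarrow> (\<forall>x. x \<noteq> 0 \<longrightarrow> (\<exists>i::nat. x = \<gamma> ^ i))"

definition cyc_C0 :: "'a::{finite,field} \<Rightarrow> nat \<Rightarrow> 'a set" where
  "cyc_C0 \<gamma> N = {(\<gamma> ^ N) ^ i | i::nat. True}"

definition gauss_period :: "nat \<Rightarrow> nat \<Rightarrow> 'a::{finite,field} \<Rightarrow> nat \<Rightarrow> nat \<Rightarrow> complex" where
  "gauss_period p f \<gamma> N a = (\<Sum>x\<in>(\<lambda>y. \<gamma> ^ a * y) ` cyc_C0 \<gamma> N. add_char p f x)"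

definition t_param :: "nat \<Rightarrow> nat \<Rightarrow> 'a::{finite,field} \<Rightarrow> nat \<Rightarrow> nat" where
  "t_param p f \<gamma> N = p ^ (GREATEST k. \<forall>chi::'a \<Rightarrow> complex.
      mult_char chi \<and> (\<exists>x. x \<noteq> 0 \<and> chi x \<noteq> 1) \<and> (\<forall>x\<in>cyc_C0 \<gamma> N. chi x = 1)
      \<longrightarrow> alg_int_dvd (of_nat (p ^ k)) (gauss_sum p f chi))"

end

theory Submission
  imports Defs "Jordan_Normal_Form.Char_Poly"
begin

text \<open>
  Since \<open>m \<ge> 2\<close>, no prime divisor of \<open>N\<close> divides \<open>p - 1\<close>, so the prime field lies in \<open>C\<^sub>0\<close> and the
  periods are integers. Fourier inversion shows that \<open>t\<close> divides every \<open>N * \<eta>\<^sub>a + 1\<close>, and with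
  \<open>w = - u * r + v * s\<close> condition (i) allows writing \<open>N * \<eta>\<^sub>a + 1 = t * (N * b\<^sub>a - w)\<close> for integers \<open>b\<^sub>a\<close>.
  The autocorrelation of the periods together with (ii) gives \<open>\<Sum> b\<^sub>a = w\<close>,
  \<open>\<Sum> b\<^sub>a\<^sup>2 = u\<^sup>2 * r + v\<^sup>2 * s\<close> and \<open>q = t\<^sup>2 * \<Sum> b\<^sub>a * (b\<^sub>a - b\<^sub>a\<^sub>+\<^sub>1)\<close>. By the last identity a common
  divisor \<open>d > 1\<close> of the \<open>b\<^sub>a\<close> would be a power of \<open>p\<close>, and then \<open>p * t\<close> would divide all the Gauss
  sums, against the maximality of \<open>t\<close>. Finally \<open>b\<close> is constant on the orbits of multiplication by \<open>p\<close>
  on \<open>\<int>/N\<close>, whose nonzero orbits have lengths divisible by \<open>m\<close>. In the cases with \<open>u = 1\<close> the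
  sum of \<open>b\<^sub>a * (b\<^sub>a + 1)\<close> is at most \<open>2 * m\<close>, so apart from \<open>0\<close> and \<open>- 1\<close> only one value occurs,
  at the index \<open>0\<close> or on a single orbit of length \<open>m\<close>; the cases with \<open>v = 1\<close> follow by replacing
  \<open>b\<close> with \<open>- b\<close>.
\<close>

section \<open>The ring of algebraic integers\<close>

text \<open>An eigenvalue of an integer matrix is a root of its characteristic polynomial, which is
  monic with integer coefficients. The bijection \<open>h\<close> only renumbers the index set
  \<open>I\<close> to fit matrix indices.\<close>

lemma algebraic_int_if_int_matrix:
  fixes \<alpha> :: complex and v :: "'i \<Rightarrow> complex"
  assumes "finite I" and nz: "\<exists>i\<in>I. v i \<noteq> 0"
    and eig: "\<And>i. i \<in> I \<Longrightarrow> \<alpha> * v i = (\<Sum>j\<in>I. of_int (A i j) * v j)"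
  shows "algebraic_int \<alpha>"
proof -
  define d where "d = card I"
  obtain h where h: "bij_betw h {0..<d} I"
    using ex_bij_betw_nat_finite[OF \<open>finite I\<close>] d_def by blast
  define M :: "int mat" where "M = Matrix.mat d d (\<lambda>(i, j). A (h i) (h j))"
  define C :: "complex mat" where "C = map_mat of_int M"
  define w :: "complex Matrix.vec" where "w = Matrix.vec d (\<lambda>i. v (h i))"
  have M: "M \<in> carrier_mat d d" and C: "C \<in> carrier_mat d d"
    by (auto simp: M_def C_def)
  have hI: "h i \<in> I" if "i < d" for i
    using h that by (auto simp: bij_betw_def)
  have "C *\<^sub>v w = \<alpha> \<cdot>\<^sub>v w"
  proof (rule eq_vecI)
    fix i assume "i < dim_vec (\<alpha> \<cdot>\<^sub>v w)"
    then have i: "i < d" by (simp add: w_def)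
    have "vec_index (C *\<^sub>v w) i = (\<Sum>j\<in>{0..<d}. of_int (A (h i) (h j)) * v (h j))"
      using i by (simp add: C_def M_def w_def scalar_prod_def)
    also have "\<dots> = (\<Sum>j\<in>I. of_int (A (h i) j) * v j)"
      using sum.reindex_bij_betw[OF h] by fastforce
    also have "\<dots> = \<alpha> * v (h i)" using eig[OF hI[OF i]] by simp
    finally show "vec_index (C *\<^sub>v w) i = vec_index (\<alpha> \<cdot>\<^sub>v w) i"
      using i by (simp add: w_def)
  qed (simp add: C_def M_def w_def)
  moreover have "w \<noteq> 0\<^sub>v d"
  proof
    assume w0: "w = 0\<^sub>v d"
    obtain i where i: "i \<in> I" "v i \<noteq> 0" using nz by blast
    then obtain k where k: "k < d" "h k = i"
      using h by (auto simp: bij_betw_def)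
    have "vec_index w k = vec_index (0\<^sub>v d) k" using w0 by simp
    then show False using k i by (simp add: w_def)
  qed
  ultimately have "eigenvalue C \<alpha>"
    using C unfolding eigenvalue_def eigenvector_def
    by (intro exI[of _ w]) (simp add: w_def)
  then have root: "poly (char_poly C) \<alpha> = 0"
    using eigenvalue_root_char_poly[OF C] by simp
  have "char_poly C = map_poly of_int (char_poly M)"
    unfolding C_def by (rule of_int_hom.char_poly_hom[OF M])
  then show ?thesis
    using root degree_monic_char_poly[OF M]
    by (auto simp: algebraic_int_altdef_ipoly intro!: exI[of _ "char_poly M"])
qed

lemma algebraic_int_monic_relation:
  fixes x :: complex
  assumes "algebraic_int x"
  obtains n c where "n > 0" "x ^ n = (\<Sum>i<n. of_int (c i) * x ^ i)"
proof -
  obtain P where P: "poly (map_poly of_int P) x = 0" "lead_coeff P = 1"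
    using assms by (auto simp: algebraic_int_altdef_ipoly)
  define n where "n = degree P"
  have "poly (map_poly of_int P) x = (\<Sum>i\<le>n. of_int (Polynomial.coeff P i) * x ^ i)"
    by (simp add: poly_altdef n_def coeff_map_poly)
  also have "\<dots> = (\<Sum>i<n. of_int (Polynomial.coeff P i) * x ^ i) + x ^ n"
    using P(2) by (simp add: n_def lessThan_Suc_atMost [symmetric])
  finally have eq: "x ^ n = (\<Sum>i<n. of_int (- Polynomial.coeff P i) * x ^ i)"
    using P(1) by (simp add: sum_negf add_eq_0_iff)
  have "n > 0"
  proof (rule ccontr)
    assume "\<not> n > 0"
    then show False using eq by simp
  qed
  then show thesis using eq by (rule that)
qed

text \<open>For finite \<open>I\<close> this is the additive group generated by the numbers
  \<open>v i\<close>, the module on which algebraic integers act.\<close>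

definition int_span :: "'i set \<Rightarrow> ('i \<Rightarrow> complex) \<Rightarrow> complex set" where
  "int_span I v = {\<Sum>i\<in>I. of_int (c i) * v i | c. True}"

lemma int_span_0: "0 \<in> int_span I v"
  unfolding int_span_def by (rule CollectI, rule exI[of _ "\<lambda>_. 0"]) simp

lemma int_span_add: "a \<in> int_span I v \<Longrightarrow> b \<in> int_span I v \<Longrightarrow> a + b \<in> int_span I v"
  unfolding int_span_def
proof clarify
  fix c c' :: "'a \<Rightarrow> int"
  show "\<exists>d. (\<Sum>i\<in>I. of_int (c i) * v i) + (\<Sum>i\<in>I. of_int (c' i) * v i)
      = (\<Sum>i\<in>I. of_int (d i) * v i) \<and> True"
    by (rule exI[of _ "\<lambda>i. c i + c' i"]) (simp add: sum.distrib algebra_simps)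
qed

lemma int_span_scale: "a \<in> int_span I v \<Longrightarrow> of_int k * a \<in> int_span I v"
  unfolding int_span_def
proof clarify
  fix c :: "'a \<Rightarrow> int"
  show "\<exists>d. of_int k * (\<Sum>i\<in>I. of_int (c i) * v i) = (\<Sum>i\<in>I. of_int (d i) * v i) \<and> True"
    by (rule exI[of _ "\<lambda>i. k * c i"]) (simp add: sum_distrib_left algebra_simps)
qed

lemma int_span_sum: "(\<And>j. j \<in> J \<Longrightarrow> g j \<in> int_span I v) \<Longrightarrow> (\<Sum>j\<in>J. g j) \<in> int_span I v"
  by (induction J rule: infinite_finite_induct) (auto intro: int_span_0 int_span_add)

lemma int_span_base:
  assumes "finite I" "i \<in> I"
  shows "v i \<in> int_span I v"
  unfolding int_span_def
proof (rule CollectI, rule exI[of _ "\<lambda>j. if j = i then 1 else 0"], rule conjI[OF _ TrueI])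
  have "(\<Sum>j\<in>I. of_int (if j = i then 1 else 0) * v j) = (\<Sum>j\<in>I. if j = i then v j else 0)"
    by (rule sum.cong) auto
  then show "v i = (\<Sum>j\<in>I. of_int (if j = i then 1 else 0) * v j)"
    using assms by simp
qed

lemma int_span_mult_closed:
  assumes "\<And>i. i \<in> I \<Longrightarrow> x * v i \<in> int_span I v" and "a \<in> int_span I v"
  shows "x * a \<in> int_span I v"
proof -
  obtain c where "a = (\<Sum>i\<in>I. of_int (c i) * v i)"
    using assms(2) by (auto simp: int_span_def)
  then have "x * a = (\<Sum>i\<in>I. of_int (c i) * (x * v i))"
    by (simp add: sum_distrib_left algebra_simps)
  then show ?thesis by (auto intro!: int_span_sum int_span_scale assms(1))
qed

text \<open>A number that maps a nonzero finitely generated additive group into itself acts on the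
  generators through an integer matrix, with the generators as eigenvector.\<close>

lemma algebraic_int_if_int_span_closed:
  assumes "finite I" "\<exists>i\<in>I. v i \<noteq> 0" "\<And>i. i \<in> I \<Longrightarrow> \<alpha> * v i \<in> int_span I v"
  shows "algebraic_int \<alpha>"
proof -
  have "\<forall>i\<in>I. \<exists>c. \<alpha> * v i = (\<Sum>j\<in>I. of_int (c j) * v j)"
    using assms(3) by (auto simp: int_span_def)
  then obtain A where "\<forall>i\<in>I. \<alpha> * v i = (\<Sum>j\<in>I. of_int (A i j) * v j)"
    by metis
  then show ?thesis
    using algebraic_int_if_int_matrix[OF assms(1,2)] by blast
qed

text \<open>The monomials \<open>x ^ i * y ^ j\<close> with exponents below the degrees of the two
  monic relations generate a group stable under \<open>x\<close> and \<open>y\<close>, hence under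
  their sum and product. It contains \<open>1\<close>, so it is nonzero.\<close>

lemma algebraic_int_add_mult:
  fixes x y :: complex
  assumes "algebraic_int x" "algebraic_int y"
  shows "algebraic_int (x + y) \<and> algebraic_int (x * y)"
proof -
  obtain n c where n: "n > 0" "x ^ n = (\<Sum>i<n. of_int (c i) * x ^ i)"
    using algebraic_int_monic_relation[OF assms(1)] .
  obtain k d where k: "k > 0" "y ^ k = (\<Sum>i<k. of_int (d i) * y ^ i)"
    using algebraic_int_monic_relation[OF assms(2)] .
  define I where "I = {..<n} \<times> {..<k}"
  define v where "v = (\<lambda>(i, j). x ^ i * y ^ j)"
  have fin: "finite I" by (simp add: I_def)
  have base: "x ^ i * y ^ j \<in> int_span I v" if "i < n" "j < k" for i j
    using int_span_base[OF fin, of "(i, j)" v] that by (simp add: I_def v_def)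
  have x: "x * v l \<in> int_span I v" if "l \<in> I" for l
  proof -
    obtain i j where l: "l = (i, j)" "i < n" "j < k" using \<open>l \<in> I\<close> by (cases l) (auto simp: I_def)
    show ?thesis
    proof (cases "Suc i < n")
      case True
      then show ?thesis using base[OF True l(3)] l by (simp add: v_def mult.assoc)
    next
      case False
      \<comment> \<open>At the top exponent the monic relation brings \<open>x ^ n\<close> back to
        lower powers.\<close>
      then have "n = Suc i" using l by simp
      then have "x * v l = x ^ n * y ^ j" using l by (simp add: v_def)
      also have "\<dots> = (\<Sum>i<n. of_int (c i) * (x ^ i * y ^ j))"
        by (simp add: n(2) sum_distrib_right mult.assoc)
      finally show ?thesis using base l by (auto intro!: int_span_sum int_span_scale)
    qed
  qed
  have y: "y * v l \<in> int_span I v" if "l \<in> I" for l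
  proof -
    obtain i j where l: "l = (i, j)" "i < n" "j < k" using \<open>l \<in> I\<close> by (cases l) (auto simp: I_def)
    show ?thesis
    proof (cases "Suc j < k")
      case True
      then show ?thesis using base[OF l(2) True] l by (simp add: v_def ac_simps)
    next
      case False
      then have "k = Suc j" using l by simp
      then have "y * v l = x ^ i * y ^ k" using l by (simp add: v_def)
      also have "\<dots> = (\<Sum>j<k. of_int (d j) * (x ^ i * y ^ j))"
        by (simp add: k(2) sum_distrib_left ac_simps)
      finally show ?thesis using base l by (auto intro!: int_span_sum int_span_scale)
    qed
  qed
  have "v (0, 0) = 1" by (simp add: v_def)
  then have nz: "\<exists>l\<in>I. v l \<noteq> 0"
    using n k by (intro bexI[of _ "(0, 0)"]) (auto simp: I_def)
  have xy: "(x + y) * v l \<in> int_span I v" if "l \<in> I" for l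
    using int_span_add[OF x[OF that] y[OF that]] by (simp add: algebra_simps)
  have xy': "(x * y) * v l \<in> int_span I v" if "l \<in> I" for l
    using int_span_mult_closed[of I x, OF x y[OF that]] by (simp add: mult.assoc)
  show ?thesis
    using algebraic_int_if_int_span_closed[OF fin nz xy]
      algebraic_int_if_int_span_closed[OF fin nz xy'] by (rule conjI)
qed

lemmas algebraic_int_add = algebraic_int_add_mult[THEN conjunct1]
  and algebraic_int_mult = algebraic_int_add_mult[THEN conjunct2]

lemma algebraic_int_sum:
  assumes "\<And>i. i \<in> I \<Longrightarrow> algebraic_int (g i :: complex)"
  shows "algebraic_int (\<Sum>i\<in>I. g i)"
  using assms
proof (induction I rule: infinite_finite_induct)
  case (insert i I)
  have "algebraic_int (g i + sum g I)"
    by (rule algebraic_int_add) (use insert in blast)+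
  then show ?case using insert.hyps by simp
qed simp_all

lemma algebraic_int_root_of_unity:
  fixes z :: complex
  assumes "z ^ n = 1" "n > 0"
  shows "algebraic_int z"
proof (rule algebraic_int_root)
  show "algebraic_int (1 :: complex)" by (rule algebraic_int_1)
  show "poly (Polynomial.monom 1 n) z = 1" using assms by (simp add: Polynomial.poly_monom)
  show "\<forall>i. Polynomial.coeff (Polynomial.monom 1 n) i \<in> (\<int> :: complex set)"
    by (simp only: coeff_monom) auto
  show "Polynomial.lead_coeff (Polynomial.monom (1::complex) n) = 1" 
    by (simp add: Polynomial.degree_monom_eq)
  show "Polynomial.degree (Polynomial.monom (1::complex) n) > 0" 
    using assms by (simp add: Polynomial.degree_monom_eq)
qed

text \<open>The quotient is rational and an algebraic integer, hence an integer.\<close>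

lemma alg_int_dvd_of_int:
  assumes "alg_int_dvd (of_nat t) (of_int y)" "t > 0"
  shows "int t dvd y"
proof -
  obtain c :: complex where c: "algebraic_int c" "of_int y = of_nat t * c"
    using assms(1) by (auto simp: alg_int_dvd_def)
  then have "c = of_int y / of_nat t" using assms(2) by simp
  then have "c \<in> \<rat>" by simp
  then have "c \<in> \<int>" using c(1) rational_algebraic_int_is_int by blast
  then obtain k where "c = of_int k" by (auto elim: Ints_cases)
  then have "complex_of_int y = of_int (int t * k)" using c(2) by simp
  then have "y = int t * k" by (simp only: of_int_eq_iff)
  then show ?thesis by simp
qed

section \<open>Integer sequences invariant under multiplication by p\<close>

text \<open>Strong induction on the cardinality removes one orbit of multiplication by
  \<open>p\<close> at a time. The orbit of \<open>a\<close> has length \<open>ord n p\<close> with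
  \<open>n = N div gcd a N\<close>, and \<open>n > 1\<close> because
  \<open>0 < a < N\<close>.\<close>

lemma dvd_card_mult_invariant_subset:
  fixes N p m :: nat
  assumes cop: "coprime N p" and ord: "\<And>n. n > 1 \<Longrightarrow> n dvd N \<Longrightarrow> m dvd ord n p"
    and "S \<subseteq> {1..<N}" and "\<And>a. a \<in> S \<Longrightarrow> a * p mod N \<in> S"
  shows "m dvd card S"
  using assms(3,4)
proof (induction "card S" arbitrary: S rule: less_induct)
  case less
  have finS: "finite S" using less.prems(1) finite_subset by blast
  show ?case
  proof (cases "S = {}")
    case False
    then obtain a where a: "a \<in> S" by blast
    then have aN: "0 < a" "a < N" using less.prems(1) by auto
    define h where "h i = a * p ^ i mod N" for i
    define g where "g = gcd a N"
    define n where "n = N div g"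
    have g: "g > 0" "g dvd a" "g dvd N" using aN by (auto simp: g_def)
    have n: "n dvd N" "n > 1"
    proof -
      show "n dvd N" using g by (simp add: n_def div_dvd_iff_mult)
      have "g \<le> a" using g aN by (simp add: dvd_imp_le)
      moreover have "N = n * g" using g by (simp add: n_def)
      ultimately show "n > 1" using aN
        by (cases n; cases "n = 1") auto
    qed
    have cn: "coprime n p" using coprime_divisors[OF n(1) dvd_refl cop] .
    define d where "d = ord n p"
    have d: "d > 0" "m dvd d" using cn ord[OF n(2,1)] by (auto simp: d_def)
    have h_eq: "h i = h j \<longleftrightarrow> [i = j] (mod d)" for i j
    proof -
      have "h i = h j \<longleftrightarrow> [a * p ^ i = a * p ^ j] (mod N)" by (simp add: h_def cong_def)
      \<comment> \<open>Dividing out \<open>g\<close> leaves the factor \<open>a div g\<close>,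
        which is invertible modulo \<open>n\<close>.\<close>
      also have "\<dots> \<longleftrightarrow> [(a div g) * p ^ i * g = (a div g) * p ^ j * g] (mod n * g)"
      proof -
        have "a * x = (a div g) * x * g" for x
          using g(2) by (metis dvd_div_mult_self mult.assoc mult.commute)
        moreover have "N = n * g" using g by (simp add: n_def)
        ultimately show ?thesis by metis
      qed
      also have "\<dots> \<longleftrightarrow> [(a div g) * p ^ i = (a div g) * p ^ j] (mod n)"
        using g by (simp add: cong_def flip: mult_mod_left)
      also have "\<dots> \<longleftrightarrow> [p ^ i = p ^ j] (mod n)"
      proof (rule cong_mult_lcancel_nat)
        show "coprime (a div g) n"
          using aN unfolding n_def g_def by (intro div_gcd_coprime) auto
      qed
      also have "\<dots> \<longleftrightarrow> [i = j] (mod d)"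
        using order_divides_expdiff[OF cn] by (simp add: d_def)
      finally show ?thesis .
    qed
    have inS: "h i \<in> S" for i
    proof (induction i)
      case 0
      then show ?case using a aN by (simp add: h_def)
    next
      case (Suc i)
      have "h (Suc i) = h i * p mod N"
        by (simp add: h_def mod_mult_left_eq) (simp add: ac_simps)
      then show ?case using less.prems(2)[OF Suc] by simp
    qed
    have ran: "range h = h ` {..<d}"
    proof -
      have "h i \<in> h ` {..<d}" for i
      proof (rule image_eqI)
        show "h i = h (i mod d)" by (simp add: h_eq cong_def)
        show "i mod d \<in> {..<d}" using d(1) by simp
      qed
      then show ?thesis by auto
    qed
    have card: "card (range h) = d"
    proof -
      have "inj_on h {..<d}"
        by (auto simp: inj_on_def h_eq cong_def)
      then show ?thesis by (simp add: ran card_image)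
    qed
    have sub: "range h \<subseteq> S" using inS by auto
    have "m dvd card (S - range h)"
    proof (rule less.hyps)
      show "card (S - range h) < card S"
      proof (rule psubset_card_mono[OF finS])
        show "S - range h \<subset> S" using inS[of 0] by blast
      qed
      show "S - range h \<subseteq> {1..<N}" using less.prems(1) by auto
      fix x assume x: "x \<in> S - range h"
      have "x * p mod N \<notin> range h"
      proof
        assume "x * p mod N \<in> range h"
        then obtain i where "x * p mod N = h i" by auto
        \<comment> \<open>Going once around the orbit exposes a factor \<open>p\<close>; cancelling
          it shows that \<open>x\<close> would itself lie in the orbit.\<close>
        also have "h i = h (Suc (i + (d - 1)))"
          using d(1) by (simp add: h_eq cong_def)
        finally have "[x * p = a * p ^ (i + (d - 1)) * p] (mod N)"
          by (simp add: h_def cong_def ac_simps)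
        then have "[x = a * p ^ (i + (d - 1))] (mod N)"
          using cop cong_mult_rcancel_nat[of p N] by (simp add: coprime_commute)
        then have "x = h (i + (d - 1))"
          using x less.prems(1) by (auto simp: h_def cong_def)
        then show False using x by auto
      qed
      then show "x * p mod N \<in> S - range h" using less.prems(2) x by auto
    qed
    moreover have "card S = card (S - range h) + d"
      using sub finS card by (metis card_Diff_subset card_mono finite_subset le_add_diff_inverse2)
    ultimately show ?thesis using d(2) by simp
  qed simp
qed

text \<open>The products \<open>b a * (b a + 1)\<close> are even and nonnegative and vanish exactly for
  \<open>b a \<in> {0, - 1}\<close>; since any other value is taken on a multiple of \<open>m\<close> nonzero indices,
  a total of at most \<open>2 * m\<close> leaves room for at most one such value.\<close>

lemma pronic_sum_dichotomy:
  fixes b :: "nat \<Rightarrow> int" and N m :: nat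
  assumes "N > 0" and cnt: "\<And>c. m dvd card {a \<in> {1..<N}. b a = c}"
    and sum: "(\<Sum>a<N. b a * (b a + 1)) = 2 * M" and M: "M \<le> int m"
  shows "b 0 * (b 0 + 1) = 2 * M \<and> (\<forall>a\<in>{1..<N}. b a \<in> {0, -1}) \<or>
    M = int m \<and> b 0 \<in> {0, -1} \<and>
      (\<exists>c\<in>{1, -2}. card {a \<in> {1..<N}. b a = c} = m \<and> (\<forall>a\<in>{1..<N}. b a \<in> {0, -1, c}))"
proof -
  define g where "g x = x * (x + 1)" for x :: int
  have g_nonneg: "g x \<ge> 0" for x
    by (cases "x \<ge> 0") (auto simp: g_def mult_nonpos_nonpos)
  have g_zero: "g x = 0 \<longleftrightarrow> x \<in> {0, -1}" for x by (auto simp: g_def)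
  \<comment> \<open>The function \<open>g\<close> is \<open>0\<close> at \<open>0\<close> and
    \<open>-1\<close>, equals \<open>2\<close> at \<open>1\<close> and \<open>-2\<close>, and is at
    least \<open>6\<close> elsewhere.\<close>
  have g_ge: "g x \<ge> 6" if "x \<notin> {0, -1, 1, -2}" for x
  proof (cases "x \<ge> 0")
    case True
    then have "2 * 3 \<le> x * (x + 1)" using that by (intro mult_mono) auto
    then show ?thesis by (simp add: g_def)
  next
    case False
    then have "3 * 2 \<le> (- x) * (- (x + 1))" using that by (intro mult_mono) auto
    then show ?thesis by (simp add: g_def algebra_simps)
  qed
  have split: "{..<N} = insert 0 {1..<N}" using \<open>N > 0\<close> by auto
  have tot: "g (b 0) + (\<Sum>a\<in>{1..<N}. g (b a)) = 2 * M"
    using sum by (simp add: split g_def)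
  show ?thesis
  proof (cases "\<forall>a\<in>{1..<N}. b a \<in> {0, -1}")
    case True
    then have "(\<Sum>a\<in>{1..<N}. g (b a)) = 0"
      using g_zero by (intro sum.neutral) auto
    then show ?thesis using tot True by (simp add: g_def)
  next
    case False
    then obtain a where a: "a \<in> {1..<N}" "b a \<notin> {0, -1}" by blast
    define c where "c = b a"
    define S where "S = {a \<in> {1..<N}. b a = c}"
    have S: "finite S" "S \<subseteq> {1..<N}" by (auto simp: S_def)
    have m0: "card S > 0" using a by (auto simp: S_def c_def card_gt_0_iff)
    then have mS: "m \<le> card S" using cnt[of c] by (simp add: S_def dvd_imp_le)
    define R where "R = (\<Sum>a\<in>{1..<N} - S. g (b a))"
    have R0: "R \<ge> 0" using g_nonneg by (simp add: R_def sum_nonneg)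
    have "(\<Sum>a\<in>{1..<N}. g (b a)) = R + (\<Sum>a\<in>S. g (b a))"
      using S by (simp add: R_def sum.subset_diff)
    also have "(\<Sum>a\<in>S. g (b a)) = int (card S) * g c"
      by (simp add: S_def)
    finally have tot': "g (b 0) + R + int (card S) * g c = 2 * M" using tot by simp
    have gc: "g c \<ge> 2"
      using g_ge[of c] a by (cases "c \<in> {1, -2}") (auto simp: g_def c_def)
    \<comment> \<open>The chain \<open>2 * m \<le> 2 * card S \<le> card S * g c \<le> 2 * M \<le> 2
      * m\<close> forces equality throughout, so index \<open>0\<close> and the indices outside
      \<open>S\<close> contribute nothing.\<close>
    have "int (card S) * 2 \<le> int (card S) * g c" using gc by (intro mult_left_mono) auto
    moreover have "int (card S) * g c \<le> 2 * int m"
      using tot' R0 g_nonneg[of "b 0"] M by linarith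
    ultimately have cm: "card S = m" using mS by linarith
    then have eqs: "M = int m" "R = 0" "g (b 0) = 0"
      using tot' R0 g_nonneg[of "b 0"] M \<open>int (card S) * 2 \<le> int (card S) * g c\<close> by linarith+
    then have "g c = 2" using tot' m0 cm by simp
    then have c: "c \<in> {1, -2}" using g_ge[of c] a by (auto simp: c_def)
    have "\<forall>x\<in>{1..<N} - S. g (b x) = 0"
      using eqs(2) g_nonneg unfolding R_def by (subst (asm) sum_nonneg_eq_0_iff) auto
    then have "\<forall>x\<in>{1..<N}. b x \<in> {0, -1, c}"
      using g_zero by (auto simp: S_def)
    then show ?thesis using eqs g_zero c cm by (auto simp: S_def)
  qed
qed

section \<open>From the sum of \<open>b a * (b a + 1)\<close> to exactly three values\<close>

lemma card_image_three:
  assumes "f ` A \<subseteq> {x, y, z}" "x \<noteq> y" "x \<noteq> z" "y \<noteq> z"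
    "\<exists>a\<in>A. f a = x" "\<exists>a\<in>A. f a = y" "\<exists>a\<in>A. f a = z"
  shows "card (f ` A) = 3"
proof -
  have "f ` A = {x, y, z}" using assms by blast
  then show ?thesis using assms by simp
qed

lemma sum_two_valued:
  fixes b :: "'a \<Rightarrow> int"
  assumes "finite A" "\<forall>a\<in>A. b a \<in> {0, -1}"
  shows "(\<Sum>a\<in>A. b a) = - int (card {a \<in> A. b a = -1})"
proof -
  have "(\<Sum>a\<in>A. b a) = (\<Sum>a\<in>A. if b a = -1 then -1 else 0)"
    using assms(2) by (intro sum.cong) auto
  also have "\<dots> = (\<Sum>a\<in>{a \<in> A. b a = -1}. -1)"
    using assms(1) by (rule sum.inter_filter [symmetric])
  finally show ?thesis by simp
qed

text \<open>In both alternatives of the dichotomy the total \<open>W\<close> determines the number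
  \<open>k\<close> of indices with value \<open>-1\<close>. The bounds \<open>HA\<close> and
  \<open>HB\<close> keep these indices from exhausting the ones left over, so \<open>0\<close>
  occurs. That \<open>-1\<close> occurs follows from these bounds or from the absence of a common
  divisor.\<close>

lemma three_values_if_pronic_sum:
  fixes b :: "nat \<Rightarrow> int" and N m :: nat
  assumes "N > 0" and "m > 0"
    and cnt: "\<And>c. m dvd card {a \<in> {1..<N}. b a = c}"
    and prim: "\<And>d. d \<ge> 2 \<Longrightarrow> \<exists>a<N. \<not> d dvd b a"
    and sum: "(\<Sum>a<N. b a * (b a + 1)) = 2 * M" and M: "0 < M" "M \<le> int m"
    and W: "(\<Sum>a<N. b a) = W"
    and HA: "\<And>x. x * (x + 1) = 2 * M \<Longrightarrow> x + 1 < W + int N \<and> (x = 1 \<longrightarrow> W \<noteq> 1)"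
    and HB: "M = int m \<Longrightarrow> W < int m \<and> 2 * int m < W + int N"
  shows "card (b ` {..<N}) = 3"
  using pronic_sum_dichotomy[OF \<open>N > 0\<close> cnt sum M(2)]
proof (elim disjE conjE bexE)
  assume b0: "b 0 * (b 0 + 1) = 2 * M" and b: "\<forall>a\<in>{1..<N}. b a \<in> {0, -1}"
  have split: "{..<N} = insert 0 {1..<N}" using \<open>N > 0\<close> by auto
  define k where "k = card {a \<in> {1..<N}. b a = -1}"
  have Wk: "W = b 0 - int k"
    using W sum_two_valued[OF _ b] by (simp add: split k_def)
  have ne: "b 0 \<noteq> 0" "b 0 \<noteq> -1" using b0 M(1) by auto
  have "k > 0"
  proof (rule ccontr)
    assume "\<not> k > 0"
    then have "k = 0" by simp
    then have "{a \<in> {1..<N}. b a = -1} = {}" by (simp add: k_def)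
    then have z: "\<forall>a\<in>{1..<N}. b a = 0" using b by blast
    \<comment> \<open>With \<open>k = 0\<close> the entry \<open>b 0\<close> is the only nonzero one
      and divides all others. Only \<open>b 0 = 1\<close> escapes \<open>prim\<close> and needs the
      extra clause of \<open>HA\<close>; \<open>-1\<close> is already excluded.\<close>
    have "b 0 \<noteq> 1" using HA[OF b0] Wk \<open>k = 0\<close> by auto
    then have "\<bar>b 0\<bar> \<ge> 2" using ne by linarith
    from prim[OF this] obtain a where "a < N" "\<not> \<bar>b 0\<bar> dvd b a" by blast
    then show False using z by (cases "a = 0") auto
  qed
  then have e1: "\<exists>a\<in>{..<N}. b a = -1"
    by (auto simp: k_def card_gt_0_iff)
  have "int k < int N - 1" using HA[OF b0] Wk by simp
  then have "k < card {1..<N}" by simp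
  then have "{a \<in> {1..<N}. b a = -1} \<noteq> {1..<N}" by (metis k_def less_irrefl)
  then have e0: "\<exists>a\<in>{..<N}. b a = 0" using b by force
  show ?thesis
    by (rule card_image_three[of _ _ "b 0" 0 "-1"]) (use ne e1 e0 b \<open>N > 0\<close> split in auto)
next
  fix c assume Mm: "M = int m" and b0: "b 0 \<in> {0, -1}" and c: "c \<in> {1, -2}"
    and cc: "card {a \<in> {1..<N}. b a = c} = m" and b: "\<forall>a\<in>{1..<N}. b a \<in> {0, -1, c}"
  define S where "S = {a \<in> {1..<N}. b a = c}"
  define R where "R = {..<N} - S"
  define k where "k = card {a \<in> R. b a = -1}"
  have S: "finite S" "S \<subseteq> {..<N}" by (auto simp: S_def)
  have R: "finite R" "\<forall>a\<in>R. b a \<in> {0, -1}"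
    proof -
    show "finite R" by (simp add: R_def)
    show "\<forall>a\<in>R. b a \<in> {0, -1}"
    proof
      fix a assume a: "a \<in> R"
      show "b a \<in> {0, -1}"
      proof (cases "a = 0")
        case False
        then have "a \<in> {1..<N}" "b a \<noteq> c" using a by (auto simp: R_def S_def)
        then show ?thesis using b by blast
      qed (use b0 in simp)
    qed
  qed
  have "(\<Sum>a<N. b a) = (\<Sum>a\<in>R. b a) + (\<Sum>a\<in>S. b a)"
    using S by (simp add: R_def sum.subset_diff)
  also have "(\<Sum>a\<in>S. b a) = int m * c" using cc by (simp add: S_def)
  finally have Wk: "W = int m * c - int k"
    using W sum_two_valued[OF R] by (simp add: k_def)
  have cR: "int (card R) = int N - int m"
  proof -
    have "card R + card S = N"
      using S by (metis R_def card_Diff_subset card_lessThan card_mono finite_lessThan le_add_diff_inverse2)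
    then show ?thesis using cc by (simp add: S_def)
  qed
  have "card S > 0" using cc \<open>m > 0\<close> by (simp only: S_def)
  then have "S \<noteq> {}" by (simp add: card_gt_0_iff)
  then have ec: "\<exists>a\<in>{..<N}. b a = c" by (auto simp: S_def)
  have "k > 0"
  proof (cases "c = 1")
    case True
    then show ?thesis using Wk HB[OF Mm] by simp
  next
    case False
    then have c2: "c = -2" using c by simp
    show ?thesis
    proof (rule ccontr)
      assume "\<not> k > 0"
      then have "{a \<in> R. b a = -1} = {}" using R by (simp add: k_def)
      then have z: "\<forall>a\<in>R. b a = 0" using R by blast
      \<comment> \<open>Without the value \<open>-1\<close> all entries would be \<open>0\<close> or
        \<open>-2\<close>, hence even.\<close>
      obtain a where a: "a < N" "\<not> 2 dvd b a" using prim[of 2] by auto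
      then have "a \<notin> R" using z by auto
      then have "b a = c" using a by (simp add: R_def S_def)
      then show False using a c2 by simp
    qed
  qed
  then have e1: "\<exists>a\<in>{..<N}. b a = -1"
    by (auto simp: k_def card_gt_0_iff R_def)
  have "int k < int (card R)"
    using c Wk HB[OF Mm] cR \<open>m > 0\<close> by auto
  then have "{a \<in> R. b a = -1} \<noteq> R" by (metis k_def less_irrefl)
  then have e0: "\<exists>a\<in>{..<N}. b a = 0" using R by (fastforce simp: R_def)
  have "b ` {..<N} \<subseteq> {c, 0, -1}" using R by (auto simp: R_def S_def)
  then show ?thesis
    by (rule card_image_three) (use c e1 e0 ec in auto)
qed

text \<open>For \<open>u = 1\<close> the terms in \<open>r\<close> cancel when the two power sums
  are added, leaving \<open>v * (v + 1) * s\<close>. This equals \<open>v * (v + 1)\<close> for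
  \<open>s = 1\<close>, and \<open>2 * m\<close> for \<open>v = 1\<close> and
  \<open>s = m\<close>.\<close>

lemma three_values_if_u_eq_1:
  fixes b :: "nat \<Rightarrow> int" and N m :: nat
  assumes "N > 0" and "m \<ge> 2"
    and cnt: "\<And>c. m dvd card {a \<in> {1..<N}. b a = c}"
    and prim: "\<And>d. d \<ge> 2 \<Longrightarrow> \<exists>a<N. \<not> d dvd b a"
    and pos: "v > 0" "r > 0" "s > 0"
    and sum1: "(\<Sum>a<N. b a) = - r + v * s" and sum2: "(\<Sum>a<N. (b a)\<^sup>2) = r + v\<^sup>2 * s"
    and alt: "s = 1 \<and> v * (v + 1) < 2 * int m \<and> r + 1 < int N
       \<or> s = 1 \<and> v * (v + 1) = 2 * int m \<and> r + v\<^sup>2 < int N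
       \<or> v = 1 \<and> s = int m \<and> r + int m < int N"
  shows "card (b ` {..<N}) = 3"
proof -
  have "(\<Sum>a<N. b a * (b a + 1)) = (\<Sum>a<N. (b a)\<^sup>2) + (\<Sum>a<N. b a)"
    by (simp add: sum.distrib power2_eq_square algebra_simps)
  then have tot: "(\<Sum>a<N. b a * (b a + 1)) = v * (v + 1) * s"
    using sum1 sum2 by (simp add: power2_eq_square algebra_simps)
  have m0: "m > 0" using \<open>m \<ge> 2\<close> by simp
  note core = three_values_if_pronic_sum[OF \<open>N > 0\<close> m0 cnt prim _ _ _ sum1]
  have v2: "v \<le> v\<^sup>2" using pos by (simp add: power2_eq_square)
  show ?thesis
  \<comment> \<open>The two alternatives with \<open>s = 1\<close> are merged. The bound on
    \<open>r + v\<^sup>2\<close> enters only at equality, where a whole orbit of \<open>m\<close>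
    nonzero indices may carry the third value.\<close>
  proof (cases "s = 1 \<and> v * (v + 1) \<le> 2 * int m \<and> r + 1 < int N
      \<and> (v * (v + 1) = 2 * int m \<longrightarrow> r + v\<^sup>2 < int N)")
    case True
    have "even (v * (v + 1))" by simp
    then obtain M where M: "v * (v + 1) = 2 * M" by blast
    have "v * (v + 1) > 0" using pos by simp
    then have M0: "0 < M" using M by linarith
    show ?thesis
    proof (rule core)
      show "(\<Sum>a<N. b a * (b a + 1)) = 2 * M" using tot M True by simp
      show "0 < M" by fact
      show "M \<le> int m" using True M by linarith
      show "x + 1 < - r + v * s + int N \<and> (x = 1 \<longrightarrow> - r + v * s \<noteq> 1)"
        if "x * (x + 1) = 2 * M" for x
      proof -
        \<comment> \<open>The candidates for \<open>b 0\<close> are thus \<open>v\<close> and its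
          mirror image \<open>- v - 1\<close>.\<close>
        have "(x - v) * (x + v + 1) = 0" using that M by (simp add: algebra_simps)
        then have "x = v \<or> x = - v - 1" by auto
        then show ?thesis using True pos by auto
      qed
      assume "M = int m"
      then have eq: "v * (v + 1) = 2 * int m" using M by simp
      then have "r + v\<^sup>2 < int N" using True by simp
      moreover have "2 * int m = v\<^sup>2 + v" using eq by (simp add: power2_eq_square algebra_simps)
      ultimately show "- r + v * s < int m \<and> 2 * int m < - r + v * s + int N"
        using True pos v2 by auto
    qed
  next
    case False
    have v1: "v = 1 \<and> s = int m \<and> r + int m < int N"
    proof (rule ccontr)
      assume "\<not> ?thesis"
      with alt have "s = 1 \<and> v * (v + 1) < 2 * int m \<and> r + 1 < int N
       \<or> s = 1 \<and> v * (v + 1) = 2 * int m \<and> r + v\<^sup>2 < int N" by blast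
      then show False using False pos v2 by auto
    qed
    show ?thesis
    proof (rule core)
      show "(\<Sum>a<N. b a * (b a + 1)) = 2 * int m" using tot v1 by simp
      show "0 < int m" "int m \<le> int m" using m0 by auto
      show "x + 1 < - r + v * s + int N \<and> (x = 1 \<longrightarrow> - r + v * s \<noteq> 1)"
        if x: "x * (x + 1) = 2 * int m" for x
      proof -
        have x1: "x \<noteq> 1" using x \<open>m \<ge> 2\<close> by auto
        have "x + 1 \<le> int m"
        proof (cases "x \<ge> 2")
          case True
          then have "2 * (x + 1) \<le> x * (x + 1)" by (intro mult_right_mono) auto
          then show ?thesis using x by simp
        next
          case False
          then show ?thesis using \<open>m \<ge> 2\<close> x1 by simp
        qed
        then show ?thesis using x1 v1 m0 by auto
      qed
      show "- r + v * s < int m \<and> 2 * int m < - r + v * s + int N" using v1 pos by auto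
    qed
  qed
qed

text \<open>Negating \<open>b\<close> exchanges the pair \<open>u\<close>, \<open>r\<close> with the
  pair \<open>v\<close>, \<open>s\<close>, which reduces the alternatives with \<open>v = 1\<close>
  to those with \<open>u = 1\<close>.\<close>

lemma three_values_if_power_sums:
  fixes b :: "nat \<Rightarrow> int" and N m :: nat
  assumes N: "N > 0" and m: "m \<ge> 2"
    and cnt: "\<And>c. m dvd card {a \<in> {1..<N}. b a = c}"
    and prim: "\<And>d. d \<ge> 2 \<Longrightarrow> \<exists>a<N. \<not> d dvd b a"
    and pos: "u > 0" "v > 0" "r > 0" "s > 0"
    and sum1: "(\<Sum>a<N. b a) = - u * r + v * s"
    and sum2: "(\<Sum>a<N. (b a)\<^sup>2) = u\<^sup>2 * r + v\<^sup>2 * s"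
    and alt: "(u = 1 \<and> s = 1 \<and> v * (v + 1) < 2 * int m \<and> r + 1 < int N)
       \<or> (u = 1 \<and> s = 1 \<and> v * (v + 1) = 2 * int m \<and> r + v^2 < int N)
       \<or> (v = 1 \<and> r = 1 \<and> u * (u + 1) < 2 * int m \<and> s + 1 < int N)
       \<or> (v = 1 \<and> r = 1 \<and> u * (u + 1) = 2 * int m \<and> s + u^2 < int N)
       \<or> (u = 1 \<and> v = 1 \<and> s = int m \<and> r + int m < int N)
       \<or> (u = 1 \<and> v = 1 \<and> r = int m \<and> s + int m < int N)"
  shows "card (b ` {..<N}) = 3"
proof (cases "u = 1 \<and> (s = 1 \<and> v * (v + 1) < 2 * int m \<and> r + 1 < int N
       \<or> s = 1 \<and> v * (v + 1) = 2 * int m \<and> r + v\<^sup>2 < int N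
       \<or> v = 1 \<and> s = int m \<and> r + int m < int N)")
  case True
  show ?thesis
    by (rule three_values_if_u_eq_1[OF N m cnt prim pos(2,3,4)]) (use True sum1 sum2 in auto)
next
  case False
  then have v: "v = 1" and alt': "r = 1 \<and> u * (u + 1) < 2 * int m \<and> s + 1 < int N
       \<or> r = 1 \<and> u * (u + 1) = 2 * int m \<and> s + u\<^sup>2 < int N
       \<or> u = 1 \<and> r = int m \<and> s + int m < int N"
    using alt by blast+
  have "card ((\<lambda>a. - b a) ` {..<N}) = 3"
  proof (rule three_values_if_u_eq_1[OF N m _ _ pos(1,4,3) _ _ alt'])
    show "m dvd card {a \<in> {1..<N}. - b a = c}" for c
    proof -
      have "{a \<in> {1..<N}. - b a = c} = {a \<in> {1..<N}. b a = - c}" by auto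
      then show ?thesis using cnt[of "- c"] by metis
    qed
    show "\<exists>a<N. \<not> d dvd - b a" if "d \<ge> 2" for d using prim[OF that] by simp
    show "(\<Sum>a<N. - b a) = - s + u * r" using sum1 v by (simp add: sum_negf)
    show "(\<Sum>a<N. (- b a)\<^sup>2) = s + u\<^sup>2 * r" using sum2 v by simp
  qed
  moreover have "(\<lambda>a. - b a) ` {..<N} = uminus ` (b ` {..<N})" by auto
  moreover have "card (uminus ` (b ` {..<N})) = card (b ` {..<N})"
    by (rule card_image) simp
  ultimately show ?thesis by simp
qed

section \<open>The canonical additive character\<close>

lemma cis_power_eq_1_iff:
  assumes "n > 0"
  shows "cis (2 * pi / real n) ^ k = 1 \<longleftrightarrow> n dvd k"
proof -
  have "cis (2 * pi / real n) ^ k = exp (2 * of_real pi * \<i> * of_nat k / of_nat n)"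
  proof -
    have "\<i> * complex_of_real (2 * pi / real n) * of_nat k
        = 2 * of_real pi * \<i> * of_nat k / of_nat n" by (simp add: mult_ac)
    then show ?thesis by (simp only: cis_conv_exp exp_of_nat2_mult [symmetric])
  qed
  then show ?thesis using complex_root_unity_eq_1[of n k] assms by simp
qed

lemma power_cong_exponent:
  fixes z :: "'a :: monoid_mult"
  assumes "z ^ n = 1" "[i = j] (mod n)"
  shows "z ^ i = z ^ j"
proof -
  have "z ^ k = z ^ (k mod n)" for k
  proof -
    have "z ^ (n * (k div n) + k mod n) = z ^ (k mod n)"
      by (simp only: power_add power_mult assms(1) power_one mult_1_left)
    then show ?thesis by (simp only: mult_div_mod_eq)
  qed
  then show ?thesis using assms(2) by (metis cong_def)
qed

lemma sum_root_of_unity_powers: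
  fixes z :: "'a :: field"
  assumes "z ^ n = 1" "z \<noteq> 1"
  shows "(\<Sum>i<n. z ^ i) = 0"
  using assms by (simp add: geometric_sum)

lemma sum_lessThan_shift_periodic:
  fixes g :: "nat \<Rightarrow> 'b :: ab_group_add"
  assumes "\<And>i. g (i + n) = g i"
  shows "(\<Sum>i<n. g (i + k)) = (\<Sum>i<n. g i)"
proof (induction k)
  case (Suc k)
  have "(\<Sum>i<n. g (Suc i + k)) + g k = (\<Sum>i<n. g (i + k)) + g (n + k)"
    using sum.lessThan_Suc_shift[of "\<lambda>i. g (i + k)" n] sum.lessThan_Suc[of "\<lambda>i. g (i + k)" n]
    by (simp add: add.commute)
  then show ?case using Suc assms[of k] by (simp add: add.commute)
qed simp

lemma sum_lessThan_mult_split: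
  fixes g :: "nat \<Rightarrow> 'b :: comm_monoid_add"
  assumes "N > 0"
  shows "(\<Sum>n<N * K. g n) = (\<Sum>a<N. \<Sum>i<K. g (a + N * i))"
proof -
  have "(\<Sum>a<N. \<Sum>i<K. g (a + N * i)) = (\<Sum>(a, i)\<in>{..<N} \<times> {..<K}. g (a + N * i))"
    by (simp add: sum.cartesian_product)
  also have "\<dots> = (\<Sum>n<N * K. g n)"
  proof (rule sum.reindex_bij_witness[of _ "\<lambda>n. (n mod N, n div N)" "\<lambda>(a, i). a + N * i"])
    fix x assume x: "x \<in> {..<N} \<times> {..<K}"
    obtain a i where ai: "x = (a, i)" by (cases x)
    then have *: "a < N" "i < K" using x by auto
    have "a + N * i < N * Suc i" using * by simp
    also have "\<dots> \<le> N * K" using * by (intro mult_left_mono) auto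
    finally show "(case x of (a, i) \<Rightarrow> a + N * i) \<in> {..<N * K}" by (simp add: ai)
  qed (use assms in \<open>auto simp: less_mult_imp_div_less mult.commute\<close>)
  finally show ?thesis ..
qed

section \<open>Frobenius, trace and orthogonality over a finite field\<close>

locale finite_field_char =
  fixes p f :: nat and ty :: "'a :: {finite, field} itself"
  assumes prime_p: "prime p" and f_pos: "f > 0" and card_field: "CARD('a) = p ^ f"
    and char_p: "(of_nat p :: 'a) = 0"
begin

abbreviation q :: nat where "q \<equiv> p ^ f"
abbreviation Tr :: "'a \<Rightarrow> 'a" where "Tr \<equiv> ff_trace p f"
abbreviation \<psi> :: "'a \<Rightarrow> complex" where "\<psi> \<equiv> add_char p f"

lemma p_gt_1: "p > 1" and p_gt_0: "p > 0"
  using prime_gt_1_nat[OF prime_p] prime_gt_0_nat[OF prime_p] by simp_all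

lemma q_gt_1: "q > 1"
  using p_gt_1 f_pos by (rule one_less_power)

lemma CHAR_eq: "CHAR('a) = p"
proof -
  have "CHAR('a) dvd p" using char_p by (simp add: of_nat_eq_0_iff_char_dvd)
  then show ?thesis using prime_p CHAR_not_1'[where 'a = 'a] by (auto simp: prime_nat_iff)
qed

lemma frobenius_add: "(x + y :: 'a) ^ (p ^ i) = x ^ (p ^ i) + y ^ (p ^ i)"
  using freshmans_dream'[where 'a = 'a, of "p ^ i" i x y] CHAR_eq prime_p by simp

lemma frobenius_sum: "(sum g A :: 'a) ^ p = (\<Sum>i\<in>A. g i ^ p)"
  by (rule freshmans_dream_sum) (simp_all add: CHAR_eq prime_p)

text \<open>Multiplication by \<open>x\<close> permutes the nonzero elements, so it leaves their
  product unchanged.\<close>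

lemma power_q_minus_1:
  assumes "(x :: 'a) \<noteq> 0"
  shows "x ^ (q - 1) = 1"
proof -
  have "(\<Prod>y\<in>UNIV - {0}. x * y) = x ^ (q - 1) * \<Prod>(UNIV - {0})"
    by (simp add: prod.distrib card_field)
  moreover have "(\<Prod>y\<in>UNIV - {0}. x * y) = \<Prod>(UNIV - {0})"
    by (rule prod.reindex_bij_witness[of _ "\<lambda>y. y / x" "\<lambda>y. x * y"]) (use assms in auto)
  moreover have "\<Prod>(UNIV - {0 :: 'a}) \<noteq> 0" by simp
  ultimately show ?thesis by simp
qed

lemma power_q: "(x :: 'a) ^ q = x"
proof (cases "x = 0")
  case False
  have "Suc (q - 1) = q" using q_gt_1 by simp
  then have "x ^ q = x * x ^ (q - 1)" by (metis power_Suc)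
  then show ?thesis using power_q_minus_1[OF False] by simp
qed (use p_gt_0 in simp)

lemma inj_frobenius: "inj (\<lambda>x :: 'a. x ^ p)"
proof (rule injI)
  fix x y :: 'a
  assume "x ^ p = y ^ p"
  then have "(x ^ p) ^ (p ^ (f - 1)) = (y ^ p) ^ (p ^ (f - 1))" by simp
  then have "x ^ (p ^ Suc (f - 1)) = y ^ (p ^ Suc (f - 1))" by (simp add: power_mult)
  then show "x = y" using power_q f_pos by simp
qed

lemma Tr_add: "Tr (x + y) = Tr x + Tr y"
  by (simp add: ff_trace_def frobenius_add sum.distrib)

text \<open>Frobenius shifts the summands of the trace cyclically; adding \<open>x\<close> on both
  sides avoids splitting off the wrapped term.\<close>

lemma Tr_power_p: "Tr (x ^ p) = Tr x"
proof -
  have "Tr (x ^ p) + x = (\<Sum>i<f. x ^ (p ^ Suc i)) + x ^ (p ^ 0)"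
    by (simp add: ff_trace_def power_mult)
  also have "\<dots> = (\<Sum>i<Suc f. x ^ (p ^ i))"
    by (subst sum.lessThan_Suc_shift) (simp add: add.commute)
  also have "\<dots> = Tr x + x" by (simp add: ff_trace_def power_q)
  finally show ?thesis by simp
qed

lemma Tr_power: "Tr x ^ p = Tr x"
proof -
  have "Tr x ^ p = Tr (x ^ p)"
    by (simp add: ff_trace_def frobenius_sum flip: power_mult) (simp add: mult.commute)
  then show ?thesis by (simp add: Tr_power_p)
qed

lemma of_nat_power_p: "(of_nat k :: 'a) ^ p = of_nat k"
proof (induction k)
  case 0
  then show ?case using p_gt_0 by simp
next
  case (Suc k)
  then show ?case using frobenius_add[of 1 "of_nat k" 1] by simp
qed

lemma of_nat_eq_iff_cong: "(of_nat i :: 'a) = of_nat j \<longleftrightarrow> [i = j] (mod p)"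
  using of_nat_eq_iff_cong_CHAR[where 'a = 'a, of i j] CHAR_eq by simp

text \<open>The polynomial \<open>x ^ p - x\<close> has at most \<open>p\<close> roots, and the
  images of \<open>0, ..., p - 1\<close> already supply that many.\<close>

lemma prime_field_cases:
  assumes "(y :: 'a) ^ p = y"
  obtains k where "k < p" "y = of_nat k"
proof -
  define P :: "'a poly" where "P = Polynomial.monom 1 p - Polynomial.monom 1 1"
  have "Polynomial.coeff P p = 1" using p_gt_1 by (simp add: P_def)
  then have P0: "P \<noteq> 0" by auto
  have deg: "Polynomial.degree P \<le> p"
    using p_gt_1 unfolding P_def by (intro degree_diff_le) (auto simp: Polynomial.degree_monom_eq)
  have roots: "{x. poly P x = 0} = {x. x ^ p = x}" by (auto simp: P_def Polynomial.poly_monom)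
  have "card {x :: 'a. x ^ p = x} \<le> p"
    using card_poly_roots_bound[OF P0] deg roots by simp
  moreover have "card (of_nat ` {..<p} :: 'a set) = p"
  proof -
    have "inj_on (of_nat :: nat \<Rightarrow> 'a) {..<p}"
      by (auto simp: inj_on_def of_nat_eq_iff_cong cong_def)
    then show ?thesis by (simp add: card_image)
  qed
  moreover have "of_nat ` {..<p} \<subseteq> {x :: 'a. x ^ p = x}" by (auto simp: of_nat_power_p)
  ultimately have "of_nat ` {..<p} = {x :: 'a. x ^ p = x}"
    by (intro card_seteq) auto
  then have "y \<in> of_nat ` {..<p}" using assms by auto
  then show thesis using that by auto
qed

text \<open>The trace is a polynomial function of degree at most \<open>p ^ (f - 1) < q\<close>. Its
  linear coefficient is \<open>1\<close>, so it cannot vanish at all \<open>q\<close>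
  elements.\<close>

lemma ex_Tr_nonzero: "\<exists>x. Tr x \<noteq> 0"
proof (rule ccontr)
  assume "\<not> (\<exists>x. Tr x \<noteq> 0)"
  then have all: "Tr x = 0" for x by auto
  define P :: "'a poly" where "P = (\<Sum>i<f. Polynomial.monom 1 (p ^ i))"
  have "Polynomial.coeff P 1 = (\<Sum>i<f. if i = 0 then 1 else 0)"
    using p_gt_1 unfolding P_def by (simp add: coeff_sum)
  then have "Polynomial.coeff P 1 = 1" using f_pos by simp
  then have P0: "P \<noteq> 0" by auto
  have deg: "Polynomial.degree P \<le> p ^ (f - 1)"
    unfolding P_def
  proof (rule degree_sum_le)
    fix i assume "i \<in> {..<f}"
    then have "p ^ i \<le> p ^ (f - 1)" using p_gt_1 by (intro power_increasing) auto
    then show "Polynomial.degree (Polynomial.monom (1 :: 'a) (p ^ i)) \<le> p ^ (f - 1)"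
      by (simp add: Polynomial.degree_monom_eq)
  qed simp
  have "poly P x = Tr x" for x by (simp add: P_def ff_trace_def poly_sum Polynomial.poly_monom)
  then have "{x. poly P x = 0} = UNIV" using all by auto
  then have "q \<le> p ^ (f - 1)"
    using card_poly_roots_bound[OF P0] deg card_field by simp
  moreover have "p ^ (f - 1) < q" using p_gt_1 f_pos by simp
  ultimately show False by simp
qed

text \<open>Any representative may replace the least one, because the base is a \<open>p\<close>-th
  root of unity.\<close>

lemma psi_eq:
  assumes "of_nat k = Tr x"
  shows "\<psi> x = cis (2 * pi / real p) ^ k"
proof -
  have "of_nat (LEAST k. (of_nat k :: 'a) = Tr x) = Tr x"
    using assms by (rule LeastI)
  then have "[(LEAST k. (of_nat k :: 'a) = Tr x) = k] (mod p)"
    using assms by (simp flip: of_nat_eq_iff_cong)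
  moreover have "cis (2 * pi / real p) ^ p = 1"
    using p_gt_0 by (simp add: cis_power_eq_1_iff)
  ultimately show ?thesis
    unfolding add_char_def by (intro power_cong_exponent)
qed

lemma Tr_of_nat:
  obtains k where "of_nat k = Tr x"
  using prime_field_cases[OF Tr_power] by metis

lemma psi_add: "\<psi> (x + y) = \<psi> x * \<psi> y"
proof -
  obtain k l where kl: "of_nat k = Tr x" "of_nat l = Tr y" using Tr_of_nat by metis
  then have "of_nat (k + l) = Tr (x + y)" by (simp add: Tr_add)
  then have "\<psi> (x + y) = cis (2 * pi / real p) ^ (k + l)" by (rule psi_eq)
  then show ?thesis using psi_eq[OF kl(1)] psi_eq[OF kl(2)] by (simp add: power_add)
qed

lemma psi_eq_1_iff: "\<psi> x = 1 \<longleftrightarrow> Tr x = 0"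
proof -
  obtain k where k: "of_nat k = Tr x" using Tr_of_nat .
  have "\<psi> x = 1 \<longleftrightarrow> p dvd k" using psi_eq[OF k] p_gt_0 by (simp add: cis_power_eq_1_iff)
  also have "\<dots> \<longleftrightarrow> (of_nat k :: 'a) = 0"
    using CHAR_eq by (simp add: of_nat_eq_0_iff_char_dvd)
  finally show ?thesis using k by simp
qed

lemma psi_0: "\<psi> 0 = 1"
proof -
  have "Tr 0 = 0" using p_gt_0 by (simp add: ff_trace_def power_0_left)
  then show ?thesis by (simp add: psi_eq_1_iff)
qed

lemma psi_of_nat_mult: "\<psi> (of_nat j * x) = \<psi> x ^ j"
  by (induction j) (simp_all add: psi_0 psi_add algebra_simps)

lemma psi_power_p: "\<psi> x ^ p = 1"
  using psi_of_nat_mult[of p x] char_p psi_0 by simp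

lemma norm_psi: "norm (\<psi> x) = 1"
  by (simp add: add_char_def norm_power)

lemma cnj_psi: "cnj (\<psi> x) = \<psi> (- x)"
proof -
  have "\<psi> x * \<psi> (- x) = 1" using psi_add[of x "- x"] by (simp add: psi_0)
  moreover have "\<psi> x * cnj (\<psi> x) = 1" by (simp add: complex_norm_square [symmetric] norm_psi)
  moreover have "\<psi> x \<noteq> 0" using norm_psi[of x] by auto
  ultimately show ?thesis by (metis mult_left_cancel)
qed

lemma psi_frobenius: "\<psi> (x ^ p) = \<psi> x"
  by (simp add: add_char_def Tr_power_p)

text \<open>Translation by some \<open>z\<close> with \<open>\<psi> z \<noteq> 1\<close> preserves
  the sum and also multiplies it by \<open>\<psi> z\<close>.\<close>

lemma sum_psi: "(\<Sum>x\<in>UNIV. \<psi> x) = 0"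
proof -
  obtain z where z: "\<psi> z \<noteq> 1" using ex_Tr_nonzero psi_eq_1_iff by blast
  have "(\<Sum>x\<in>UNIV. \<psi> x) = (\<Sum>x\<in>UNIV. \<psi> (x + z))"
    by (rule sum.reindex_bij_witness[of _ "\<lambda>x. x + z" "\<lambda>x. x - z"]) auto
  also have "\<dots> = \<psi> z * (\<Sum>x\<in>UNIV. \<psi> x)"
    by (simp add: psi_add sum_distrib_left mult.commute)
  finally show ?thesis using z by simp
qed

lemma sum_psi_mult_nonzero:
  "(\<Sum>x\<in>UNIV - {0}. \<psi> (x * z)) = (if z = 0 then of_nat q else 0) - 1"
proof (cases "z = 0")
  case True
  then show ?thesis using q_gt_1 by (simp add: psi_0 card_field)
next
  case False
  have "(\<Sum>x\<in>UNIV. \<psi> (x * z)) = (\<Sum>x\<in>UNIV. \<psi> x)"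
    by (rule sum.reindex_bij_witness[of _ "\<lambda>x. x / z" "\<lambda>x. x * z"]) (use False in auto)
  then have "(\<Sum>x\<in>UNIV. \<psi> (x * z)) = 0" by (simp add: sum_psi)
  moreover have "(\<Sum>x\<in>UNIV. \<psi> (x * z)) = (\<Sum>x\<in>UNIV - {0}. \<psi> (x * z)) + \<psi> (0 * z)"
    by (subst sum.remove[of _ 0]) (auto simp: add.commute)
  ultimately show ?thesis using False by (simp add: psi_0 eq_neg_iff_add_eq_0)
qed

end

section \<open>Gauss periods\<close>

locale gauss_periods = finite_field_char p f ty for p f :: nat and ty :: "'a :: {finite, field} itself" +
  fixes \<gamma> :: 'a and N :: nat
  assumes N_gt_2: "N > 2" and N_dvd: "N dvd q - 1" and primitive: "primitive_elem \<gamma>"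
begin

text \<open>This is the order of the group \<open>cyc_C0 \<gamma> N\<close>.\<close>

definition K :: nat where "K = (q - 1) div N"

abbreviation \<eta> :: "nat \<Rightarrow> complex" where "\<eta> \<equiv> gauss_period p f \<gamma> N"

lemma N_K: "N * K = q - 1"
  using N_dvd by (simp add: K_def)

lemma K_pos: "K > 0"
  using N_K q_gt_1 by (cases "K = 0") auto

text \<open>The powers of \<open>0\<close> are only \<open>0\<close> and \<open>1\<close>, so they
  could cover the nonzero elements only when \<open>q = 2\<close>; but \<open>N > 2\<close> divides
  \<open>q - 1\<close>.\<close>

lemma gamma_nonzero: "\<gamma> \<noteq> 0"
proof
  assume \<gamma>: "\<gamma> = 0"
  have "x = 0 \<or> x = 1" for x :: 'a
  proof (cases "x = 0")
    case False
    then obtain i where "x = \<gamma> ^ i" using primitive by (auto simp: primitive_elem_def)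
    then show ?thesis using \<gamma> by (cases i) auto
  qed simp
  then have "(UNIV :: 'a set) \<subseteq> {0, 1}" by auto
  then have "CARD('a) \<le> card {0 :: 'a, 1}" by (intro card_mono) auto
  then have "q \<le> 2" using card_field by simp
  then have "N * K \<le> 1" using N_K by simp
  then show False using N_gt_2 K_pos by (cases K) auto
qed

lemma gamma_power_cong: "[i = j] (mod (q - 1)) \<Longrightarrow> \<gamma> ^ i = \<gamma> ^ j"
  by (rule power_cong_exponent[OF power_q_minus_1[OF gamma_nonzero]])

text \<open>Exponents below \<open>q - 1\<close> reach all \<open>q - 1\<close> nonzero elements, so
  counting gives injectivity.\<close>

lemma bij_gamma: "bij_betw (\<lambda>i. \<gamma> ^ i) {..<q - 1} (UNIV - {0})"
proof -
  have img: "(\<lambda>i. \<gamma> ^ i) ` {..<q - 1} = UNIV - {0}"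
  proof (intro equalityI subsetI)
    fix x :: 'a assume "x \<in> UNIV - {0}"
    then obtain i where i: "x = \<gamma> ^ i" using primitive by (auto simp: primitive_elem_def)
    have "x = \<gamma> ^ (i mod (q - 1))" unfolding i by (rule gamma_power_cong) (simp add: cong_def)
    moreover have "i mod (q - 1) < q - 1" using q_gt_1 by simp
    ultimately show "x \<in> (\<lambda>i. \<gamma> ^ i) ` {..<q - 1}" by blast
  qed (use gamma_nonzero in auto)
  have "inj_on (\<lambda>i. \<gamma> ^ i) {..<q - 1}"
  proof (rule eq_card_imp_inj_on)
    show "card ((\<lambda>i. \<gamma> ^ i) ` {..<q - 1}) = card {..<q - 1}"
      unfolding img by (simp add: card_field)
  qed simp
  then show ?thesis using img by (rule bij_betw_imageI)
qed

lemma gamma_power_eq_iff: "\<gamma> ^ i = \<gamma> ^ j \<longleftrightarrow> [i = j] (mod (q - 1))"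
proof
  assume eq: "\<gamma> ^ i = \<gamma> ^ j"
  have "\<gamma> ^ (k mod (q - 1)) = \<gamma> ^ k" for k by (rule gamma_power_cong) (simp add: cong_def)
  then have "\<gamma> ^ (i mod (q - 1)) = \<gamma> ^ (j mod (q - 1))" using eq by simp
  moreover have "i mod (q - 1) \<in> {..<q - 1}" "j mod (q - 1) \<in> {..<q - 1}" using q_gt_1 by auto
  ultimately show "[i = j] (mod (q - 1))"
    using bij_gamma unfolding cong_def bij_betw_def inj_on_def by blast
qed (rule gamma_power_cong)

lemma cyc_C0_eq: "cyc_C0 \<gamma> N = (\<lambda>i. \<gamma> ^ (N * i)) ` {..<K}"
proof (intro equalityI subsetI)
  fix x assume "x \<in> cyc_C0 \<gamma> N"
  then obtain i where i: "x = \<gamma> ^ (N * i)" by (auto simp: cyc_C0_def power_mult)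
  have "[N * i = N * (i mod K)] (mod N * K)"
    by (simp add: cong_def mult_mod_right [symmetric])
  then have "x = \<gamma> ^ (N * (i mod K))" unfolding i N_K by (rule gamma_power_cong)
  moreover have "i mod K < K" using K_pos by simp
  ultimately show "x \<in> (\<lambda>i. \<gamma> ^ (N * i)) ` {..<K}" by blast
qed (auto simp: cyc_C0_def power_mult)

lemma period_eq: "\<eta> a = (\<Sum>i<K. \<psi> (\<gamma> ^ (a + N * i)))"
proof -
  have img: "(\<lambda>y. \<gamma> ^ a * y) ` cyc_C0 \<gamma> N = (\<lambda>i. \<gamma> ^ (a + N * i)) ` {..<K}"
    by (auto simp: cyc_C0_eq power_add image_image)
  have inj: "inj_on (\<lambda>i. \<gamma> ^ (a + N * i)) {..<K}"
  proof (rule inj_onI)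
    fix i j assume ij: "i \<in> {..<K}" "j \<in> {..<K}" and eq: "\<gamma> ^ (a + N * i) = \<gamma> ^ (a + N * j)"
    have "\<gamma> ^ (N * i) = \<gamma> ^ (N * j)" using eq gamma_nonzero by (simp add: power_add)
    then have "[N * i = N * j] (mod N * K)" by (simp add: gamma_power_eq_iff N_K)
    moreover have "N * i < N * K" "N * j < N * K" using ij N_gt_2 by auto
    ultimately have "N * i = N * j" by (simp only: cong_def mod_less)
    then show "i = j" using N_gt_2 by simp
  qed
  show ?thesis
    unfolding gauss_period_def img by (simp add: sum.reindex[OF inj])
qed

lemma psi_gamma_periodic: "\<psi> (z * \<gamma> ^ (a + N * (i + K))) = \<psi> (z * \<gamma> ^ (a + N * i))"
proof -
  have "\<gamma> ^ (a + N * (i + K)) = \<gamma> ^ (a + N * i)"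
  proof (rule gamma_power_cong)
    have "a + N * (i + K) = a + N * i + (q - 1)" by (simp only: N_K [symmetric] algebra_simps)
    then show "[a + N * (i + K) = a + N * i] (mod (q - 1))" by (simp only: cong_def mod_add_self2)
  qed
  then show ?thesis by simp
qed

text \<open>Multiplication by an element of \<open>C\<^sub>0\<close> permutes each coset. The factor
  \<open>z\<close> is there for \<open>z = -1\<close>, which arises from complex
  conjugation.\<close>

lemma sum_gamma_shift:
  "(\<Sum>i<K. \<psi> (z * \<gamma> ^ (a + N * (i + k)))) = (\<Sum>i<K. \<psi> (z * \<gamma> ^ (a + N * i)))"
  by (rule sum_lessThan_shift_periodic) (rule psi_gamma_periodic)

lemma period_add_mult: "\<eta> (a + N * k) = \<eta> a"
  using sum_gamma_shift[of 1 a k] by (simp add: period_eq algebra_simps)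

lemma period_mod: "\<eta> (a mod N) = \<eta> a"
  using period_add_mult[of "a mod N" "a div N"] by simp

lemma sum_nonzero_split:
  fixes h :: "'a \<Rightarrow> complex"
  shows "(\<Sum>x\<in>UNIV - {0}. h x) = (\<Sum>a<N. \<Sum>i<K. h (\<gamma> ^ (a + N * i)))"
proof -
  have "(\<Sum>x\<in>UNIV - {0}. h x) = (\<Sum>n<N * K. h (\<gamma> ^ n))"
    unfolding N_K by (rule sum.reindex_bij_betw[OF bij_gamma, symmetric])
  then show ?thesis using sum_lessThan_mult_split[of N "\<lambda>n. h (\<gamma> ^ n)" K] N_gt_2 by simp
qed

lemma sum_periods: "(\<Sum>a<N. \<eta> a) = -1"
  using sum_psi_mult_nonzero[of 1] sum_nonzero_split[of \<psi>] by (simp add: period_eq)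

text \<open>After factoring, the sums over \<open>a\<close> and \<open>i\<close> run through all
  nonzero field elements, and orthogonality leaves a contribution \<open>q\<close> only from
  \<open>c = j = 0\<close>.\<close>

lemma period_autocorrelation:
  assumes "c < N"
  shows "(\<Sum>a<N. \<eta> a * cnj (\<eta> (a + c))) = (if c = 0 then of_nat q else 0) - of_nat K"
proof -
  have "\<eta> a * cnj (\<eta> (a + c))
      = (\<Sum>j<K. \<Sum>i<K. \<psi> (\<gamma> ^ (a + N * i) * (1 - \<gamma> ^ (c + N * j))))" for a
  proof -
    have "\<eta> a * cnj (\<eta> (a + c))
        = (\<Sum>i<K. \<psi> (\<gamma> ^ (a + N * i)) * (\<Sum>j<K. \<psi> (- (\<gamma> ^ (a + c + N * j)))))"
      by (simp add: period_eq cnj_psi sum_distrib_right)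
    \<comment> \<open>Shifting \<open>j\<close> by \<open>i\<close> makes
      \<open>\<gamma> ^ (a + N * i)\<close> a common factor of both arguments.\<close>
    also have "\<dots> = (\<Sum>i<K. \<psi> (\<gamma> ^ (a + N * i)) * (\<Sum>j<K. \<psi> (- (\<gamma> ^ (a + c + N * (j + i))))))"
      using sum_gamma_shift[of "-1" "a + c"] by simp
    also have "\<dots> = (\<Sum>i<K. \<Sum>j<K. \<psi> (\<gamma> ^ (a + N * i) * (1 - \<gamma> ^ (c + N * j))))"
    proof -
      have "\<psi> (\<gamma> ^ (a + N * i)) * \<psi> (- (\<gamma> ^ (a + c + N * (j + i))))
          = \<psi> (\<gamma> ^ (a + N * i) * (1 - \<gamma> ^ (c + N * j)))" for i j
        by (simp add: psi_add [symmetric] algebra_simps power_add)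
      then show ?thesis by (simp add: sum_distrib_left)
    qed
    finally show ?thesis by (subst sum.swap)
  qed
  then have "(\<Sum>a<N. \<eta> a * cnj (\<eta> (a + c)))
      = (\<Sum>a<N. \<Sum>j<K. \<Sum>i<K. \<psi> (\<gamma> ^ (a + N * i) * (1 - \<gamma> ^ (c + N * j))))"
    by simp
  also have "\<dots> = (\<Sum>j<K. \<Sum>a<N. \<Sum>i<K. \<psi> (\<gamma> ^ (a + N * i) * (1 - \<gamma> ^ (c + N * j))))"
    by (rule sum.swap)
  also have "\<dots> = (\<Sum>j<K. \<Sum>x\<in>UNIV - {0}. \<psi> (x * (1 - \<gamma> ^ (c + N * j))))"
    by (simp only: sum_nonzero_split)
  also have "\<dots> = (\<Sum>j<K. (if j = 0 then (if c = 0 then of_nat q else 0) else 0) - 1)"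
  proof (rule sum.cong[OF refl])
    fix j assume "j \<in> {..<K}"
    then have j: "Suc j \<le> K" by simp
    have "c + N * j < N * Suc j" using assms by simp
    also have "N * Suc j \<le> q - 1" unfolding N_K [symmetric] using j by (rule mult_le_mono2)
    finally have lt: "c + N * j < q - 1" .
    have "1 - \<gamma> ^ (c + N * j) = 0 \<longleftrightarrow> \<gamma> ^ (c + N * j) = \<gamma> ^ 0" by auto
    also have "\<dots> \<longleftrightarrow> c + N * j = 0"
      unfolding gamma_power_eq_iff using lt by (simp add: cong_def)
    also have "\<dots> \<longleftrightarrow> c = 0 \<and> j = 0" using N_gt_2 by simp
    finally show "(\<Sum>x\<in>UNIV - {0}. \<psi> (x * (1 - \<gamma> ^ (c + N * j))))
        = (if j = 0 then (if c = 0 then of_nat q else 0) else 0) - 1"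
      by (simp only: sum_psi_mult_nonzero) auto
  qed
  also have "\<dots> = (if c = 0 then of_nat q else 0) - of_nat K"
    using K_pos by (simp add: sum_subtractf)
  finally show ?thesis .
qed

section \<open>Frobenius invariance and integrality of the periods\<close>

text \<open>The map \<open>x ^ p\<close> carries the coset of \<open>\<gamma> ^ a\<close>
  bijectively onto that of \<open>\<gamma> ^ (a * p)\<close> and preserves
  \<open>\<psi>\<close>.\<close>

lemma period_frobenius: "\<eta> (a * p) = \<eta> a"
proof -
  define C where "C b = (\<lambda>y. \<gamma> ^ b * y) ` cyc_C0 \<gamma> N" for b
  have card_C: "card (C b) = card (cyc_C0 \<gamma> N)" for b
    unfolding C_def using gamma_nonzero by (intro card_image) (auto simp: inj_on_def)
  have "(\<lambda>x. x ^ p) ` C a = C (a * p)"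
  proof (rule card_subset_eq)
    show "finite (C (a * p))" by simp
    show "(\<lambda>x. x ^ p) ` C a \<subseteq> C (a * p)"
    proof clarify
      fix x assume "x \<in> C a"
      then obtain i where i: "x = \<gamma> ^ a * (\<gamma> ^ N) ^ i" by (auto simp: C_def cyc_C0_def)
      then have "x ^ p = \<gamma> ^ (a * p) * (\<gamma> ^ N) ^ (i * p)"
        by (simp add: power_mult_distrib power_mult)
      moreover have "(\<gamma> ^ N) ^ (i * p) \<in> cyc_C0 \<gamma> N" unfolding cyc_C0_def by blast
      ultimately show "x ^ p \<in> C (a * p)" by (auto simp: C_def)
    qed
    have "card ((\<lambda>x. x ^ p) ` C a) = card (C a)"
      by (rule card_image) (rule inj_on_subset[OF inj_frobenius subset_UNIV])
    then show "card ((\<lambda>x. x ^ p) ` C a) = card (C (a * p))" by (simp add: card_C)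
  qed
  then have "\<eta> (a * p) = (\<Sum>x\<in>(\<lambda>x. x ^ p) ` C a. \<psi> x)"
    by (simp add: gauss_period_def C_def)
  also have "\<dots> = (\<Sum>x\<in>C a. \<psi> (x ^ p))"
    by (rule sum.reindex_cong[OF inj_on_subset[OF inj_frobenius subset_UNIV]]) auto
  also have "\<dots> = \<eta> a" by (simp add: psi_frobenius gauss_period_def C_def)
  finally show ?thesis .
qed

lemma coprime_N_p: "coprime N p"
proof -
  have "coprime (q - 1) q" using p_gt_0 by (intro coprime_diff_one_left_nat) simp
  then have "coprime (q - 1) p" using f_pos by simp
  then show ?thesis using N_dvd coprime_divisors[OF N_dvd dvd_refl] by blast
qed

lemma algebraic_int_psi: "algebraic_int (\<psi> x)"
  using algebraic_int_root_of_unity[OF psi_power_p p_gt_0] .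

lemma algebraic_int_period: "algebraic_int (\<eta> a)"
  unfolding period_eq by (intro algebraic_int_sum algebraic_int_psi)

text \<open>Coprimality of \<open>N\<close> and \<open>p - 1\<close> puts the prime field inside \<open>C\<^sub>0\<close>, so the periods are
  fixed by the Galois group of the \<open>p\<close>-th cyclotomic field.\<close>

lemma period_in_Ints:
  assumes cop: "coprime N (p - 1)"
  shows "\<eta> a \<in> \<int>"
proof -
  \<comment> \<open>Raising \<open>\<psi>\<close> to the power \<open>j\<close> multiplies its
    argument by a prime field element \<open>\<gamma> ^ l\<close>. Coprimality gives
    \<open>N dvd l\<close>, so the coset is only permuted.\<close>
  have scale: "(\<Sum>i<K. \<psi> (\<gamma> ^ (a + N * i)) ^ j) = \<eta> a" if j: "j \<in> {1..<p}" for j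
  proof -
    have nz: "(of_nat j :: 'a) \<noteq> 0"
      using j of_nat_eq_iff_cong[of j 0] by (auto simp: cong_def)
    then obtain l where l: "of_nat j = \<gamma> ^ l"
      using primitive by (auto simp: primitive_elem_def)
    have "(of_nat j :: 'a) ^ (p - 1) = 1"
    proof -
      have "(of_nat j :: 'a) * of_nat j ^ (p - 1) = of_nat j ^ p"
        using p_gt_0 by (metis Suc_diff_1 power_Suc)
      then show ?thesis using nz of_nat_power_p[of j] by simp
    qed
    then have "\<gamma> ^ (l * (p - 1)) = \<gamma> ^ 0" using l by (simp add: power_mult)
    then have "q - 1 dvd l * (p - 1)" unfolding gamma_power_eq_iff cong_0_iff .
    then have "N dvd l * (p - 1)" using N_dvd dvd_trans by blast
    then have "N dvd l" using cop by (simp add: coprime_dvd_mult_left_iff)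
    then obtain k where k: "l = N * k" by blast
    have "(\<Sum>i<K. \<psi> (\<gamma> ^ (a + N * i)) ^ j) = (\<Sum>i<K. \<psi> (1 * \<gamma> ^ (a + N * (i + k))))"
      by (simp add: psi_of_nat_mult [symmetric] l k power_add algebra_simps)
    also have "\<dots> = \<eta> a" unfolding sum_gamma_shift by (simp add: period_eq)
    finally show ?thesis .
  qed
  \<comment> \<open>The sum over all \<open>j < p\<close> is \<open>p\<close> or \<open>0\<close>,
    and the term \<open>j = 0\<close> is \<open>1\<close>.\<close>
  have inner: "(\<Sum>j\<in>{1..<p}. \<psi> x ^ j) \<in> \<int>" for x
  proof -
    have "(\<Sum>j<p. \<psi> x ^ j) \<in> \<int>"
      using sum_root_of_unity_powers[OF psi_power_p, of x] by (cases "\<psi> x = 1") auto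
    moreover have "(\<Sum>j<p. \<psi> x ^ j) = (\<Sum>j\<in>{1..<p}. \<psi> x ^ j) + 1"
    proof -
      have "{..<p} = insert 0 {1..<p}" using p_gt_0 by auto
      then show ?thesis by simp
    qed
    ultimately have "(\<Sum>j\<in>{1..<p}. \<psi> x ^ j) + 1 - 1 \<in> \<int>"
      by (intro Ints_diff) auto
    then show ?thesis by simp
  qed
  \<comment> \<open>Averaging over \<open>j\<close> makes the period rational; as an algebraic
    integer it is then an integer.\<close>
  have "of_nat (p - 1) * \<eta> a = (\<Sum>j\<in>{1..<p}. \<Sum>i<K. \<psi> (\<gamma> ^ (a + N * i)) ^ j)"
    by (simp add: scale)
  also have "\<dots> = (\<Sum>i<K. \<Sum>j\<in>{1..<p}. \<psi> (\<gamma> ^ (a + N * i)) ^ j)" by (rule sum.swap)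
  also have "\<dots> \<in> \<int>" by (intro Ints_sum inner)
  finally have "of_nat (p - 1) * \<eta> a \<in> \<rat>" by (rule subsetD[OF Ints_subset_Rats])
  then have "of_nat (p - 1) * \<eta> a / of_nat (p - 1) \<in> \<rat>" by (intro Rats_divide) auto
  then have "\<eta> a \<in> \<rat>" using p_gt_1 by simp
  then show ?thesis using algebraic_int_period rational_algebraic_int_is_int by blast
qed

section \<open>Gauss sums\<close>

text \<open>Discrete logarithm to base \<open>\<gamma>\<close>. The value at \<open>0\<close> is
  unspecified; neither \<open>mult_char\<close> nor \<open>gauss_sum\<close> looks at it.\<close>

definition dlog :: "'a \<Rightarrow> nat" where
  "dlog x = (LEAST i. \<gamma> ^ i = x)"

lemma gamma_power_dlog:
  assumes "x \<noteq> 0"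
  shows "\<gamma> ^ dlog x = x"
proof -
  obtain i where "\<gamma> ^ i = x" using assms primitive unfolding primitive_elem_def by metis
  then show ?thesis unfolding dlog_def by (rule LeastI)
qed

text \<open>The discrete logarithm is determined modulo \<open>q - 1\<close>, hence modulo
  \<open>N\<close>.\<close>

lemma root_power_dlog:
  fixes z :: complex
  assumes "z ^ N = 1"
  shows "z ^ dlog (\<gamma> ^ i) = z ^ i"
proof -
  have "\<gamma> ^ dlog (\<gamma> ^ i) = \<gamma> ^ i" using gamma_nonzero by (intro gamma_power_dlog) simp
  then have "[dlog (\<gamma> ^ i) = i] (mod (q - 1))" by (simp only: gamma_power_eq_iff)
  then have "[dlog (\<gamma> ^ i) = i] (mod N)" using N_dvd by (rule cong_dvd_modulus_nat)
  then show ?thesis using assms by (intro power_cong_exponent)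
qed

text \<open>This names the condition on characters inside \<open>t_param\<close>. On nonzero
  elements such characters correspond to the \<open>N\<close>-th roots of unity
  \<open>chi \<gamma> \<noteq> 1\<close>.\<close>

definition C0_char :: "('a \<Rightarrow> complex) \<Rightarrow> bool" where
  "C0_char chi \<longleftrightarrow> mult_char chi \<and> (\<exists>x. x \<noteq> 0 \<and> chi x \<noteq> 1) \<and> (\<forall>x\<in>cyc_C0 \<gamma> N. chi x = 1)"

lemma C0_char_dlog:
  fixes z :: complex
  assumes z: "z ^ N = 1" "z \<noteq> 1"
  shows "C0_char (\<lambda>x. z ^ dlog x)"
  unfolding C0_char_def mult_char_def
proof (intro conjI allI impI ballI)
  fix x y :: 'a assume xy: "x \<noteq> 0" "y \<noteq> 0"
  have "x * y = \<gamma> ^ (dlog x + dlog y)" using xy by (simp add: power_add gamma_power_dlog)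
  then have "z ^ dlog (x * y) = z ^ (dlog x + dlog y)" using root_power_dlog[OF z(1)] by simp
  then show "z ^ dlog (x * y) = z ^ dlog x * z ^ dlog y" by (simp add: power_add)
next
  fix x :: 'a
  have "z \<noteq> 0" using z N_gt_2 by (auto simp: power_0_left)
  then show "z ^ dlog x \<noteq> 0" by simp
next
  show "\<exists>x. x \<noteq> 0 \<and> z ^ dlog x \<noteq> 1"
    using root_power_dlog[OF z(1), of 1] gamma_nonzero z(2) by (intro exI[of _ \<gamma>]) simp
next
  fix x assume "x \<in> cyc_C0 \<gamma> N"
  then obtain i where "x = \<gamma> ^ (N * i)" by (auto simp: cyc_C0_eq)
  then have "z ^ dlog x = z ^ (N * i)" using root_power_dlog[OF z(1)] by simp
  then show "z ^ dlog x = 1" by (simp add: power_mult z(1))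
qed

lemma C0_char_power:
  assumes "C0_char chi"
  shows "chi (\<gamma> ^ i) = chi \<gamma> ^ i"
proof (induction i)
  case 0
  have "1 \<in> cyc_C0 \<gamma> N" unfolding cyc_C0_def by (rule CollectI, rule exI[of _ 0]) simp
  then show ?case using assms by (simp add: C0_char_def)
next
  case (Suc i)
  have "chi (\<gamma> * \<gamma> ^ i) = chi \<gamma> * chi (\<gamma> ^ i)"
    using assms gamma_nonzero by (simp add: C0_char_def mult_char_def)
  then show ?case using Suc by simp
qed

lemma C0_char_root:
  assumes "C0_char chi"
  shows "chi \<gamma> ^ N = 1" "chi \<gamma> \<noteq> 1"
proof -
  have "\<gamma> ^ N \<in> cyc_C0 \<gamma> N" unfolding cyc_C0_def by (rule CollectI, rule exI[of _ 1]) simp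
  then show "chi \<gamma> ^ N = 1" using assms C0_char_power[OF assms, of N] by (simp add: C0_char_def)
  obtain x where x: "x \<noteq> 0" "chi x \<noteq> 1" using assms by (auto simp: C0_char_def)
  then have "chi \<gamma> ^ dlog x \<noteq> 1"
    using C0_char_power[OF assms, of "dlog x"] by (simp add: gamma_power_dlog)
  then show "chi \<gamma> \<noteq> 1" by auto
qed

text \<open>The character is constant on the cosets of \<open>C\<^sub>0\<close>, so its Gauss sum is
  a discrete Fourier coefficient of the periods.\<close>

lemma gauss_sum_eq:
  assumes "C0_char chi"
  shows "gauss_sum p f chi = (\<Sum>a<N. chi \<gamma> ^ a * \<eta> a)"
proof -
  have "{a :: 'a. a \<noteq> 0} = UNIV - {0}" by auto
  then have "gauss_sum p f chi
      = (\<Sum>a<N. \<Sum>i<K. chi (\<gamma> ^ (a + N * i)) * \<psi> (\<gamma> ^ (a + N * i)))"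
    unfolding gauss_sum_def by (simp only: sum_nonzero_split)
  moreover have "chi (\<gamma> ^ (a + N * i)) = chi \<gamma> ^ a" for a i
    unfolding C0_char_power[OF assms] by (simp add: power_add power_mult C0_char_root[OF assms])
  ultimately show ?thesis by (simp add: period_eq sum_distrib_left)
qed

text \<open>Fourier inversion on \<open>\<int>/N\<close>; the summand \<open>1\<close> cancels the trivial character.\<close>

lemma period_inversion:
  fixes \<zeta> :: complex
  defines "\<zeta> \<equiv> cis (2 * pi / real N)"
  assumes c: "c < N"
  shows "of_nat N * \<eta> c + 1
    = (\<Sum>j\<in>{1..<N}. gauss_sum p f (\<lambda>x. (\<zeta> ^ j) ^ dlog x) * \<zeta> ^ (j * (N - c)))"
proof -
  have N0: "N > 0" using N_gt_2 by simp
  have \<zeta>: "\<zeta> ^ k = 1 \<longleftrightarrow> N dvd k" for k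
    unfolding \<zeta>_def by (rule cis_power_eq_1_iff[OF N0])
  have g: "gauss_sum p f (\<lambda>x. (\<zeta> ^ j) ^ dlog x) = (\<Sum>a<N. \<zeta> ^ (j * a) * \<eta> a)" if "j \<in> {1..<N}" for j
  proof -
    have r: "(\<zeta> ^ j) ^ N = 1" by (simp add: \<zeta> flip: power_mult)
    have "\<zeta> ^ j \<noteq> 1" using that by (auto simp: \<zeta> dest: dvd_imp_le)
    with r have "C0_char (\<lambda>x. (\<zeta> ^ j) ^ dlog x)" by (rule C0_char_dlog)
    then show ?thesis
      using root_power_dlog[OF r, of 1] by (simp add: gauss_sum_eq power_mult)
  qed
  \<comment> \<open>The exponent \<open>N - c\<close> stands for \<open>- c\<close> in the natural
    numbers; since \<open>0 < a + (N - c) < 2 * N\<close>, only \<open>a = c\<close>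
    survives.\<close>
  have "(\<Sum>j<N. \<Sum>a<N. \<zeta> ^ (j * (a + (N - c))) * \<eta> a)
      = (\<Sum>a<N. \<eta> a * (\<Sum>j<N. (\<zeta> ^ (a + (N - c))) ^ j))"
    by (subst sum.swap) (simp add: sum_distrib_left mult.commute flip: power_mult)
  also have "\<dots> = (\<Sum>a<N. if a = c then of_nat N * \<eta> a else 0)"
  proof (rule sum.cong[OF refl])
    fix a assume a: "a \<in> {..<N}"
    have r: "(\<zeta> ^ (a + (N - c))) ^ N = 1" by (simp add: \<zeta> flip: power_mult)
    show "\<eta> a * (\<Sum>j<N. (\<zeta> ^ (a + (N - c))) ^ j) = (if a = c then of_nat N * \<eta> a else 0)"
    proof (cases "a = c")
      case True
      then have "\<zeta> ^ (a + (N - c)) = 1" using c by (simp add: \<zeta>)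
      then show ?thesis using True by simp
    next
      case False
      have "\<not> N dvd a + (N - c)"
      proof
        assume "N dvd a + (N - c)"
        then obtain l where l: "a + (N - c) = N * l" by blast
        have "0 < a + (N - c)" "a + (N - c) < N * 2" "a + (N - c) \<noteq> N"
          using a c False by auto
        then have "0 < l" "l < 2" "l \<noteq> 1" using l N0 by auto
        then show False by simp
      qed
      then have "\<zeta> ^ (a + (N - c)) \<noteq> 1" by (simp add: \<zeta>)
      then show ?thesis using sum_root_of_unity_powers[OF r] False by simp
    qed
  qed
  also have "\<dots> = of_nat N * \<eta> c" using c by simp
  finally have tot: "(\<Sum>j<N. \<Sum>a<N. \<zeta> ^ (j * (a + (N - c))) * \<eta> a) = of_nat N * \<eta> c" .
  have "{..<N} = insert 0 {1..<N}" using N0 by auto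
  then have "(\<Sum>j<N. \<Sum>a<N. \<zeta> ^ (j * (a + (N - c))) * \<eta> a)
      = (\<Sum>a<N. \<eta> a) + (\<Sum>j\<in>{1..<N}. \<Sum>a<N. \<zeta> ^ (j * (a + (N - c))) * \<eta> a)"
    by simp
  also have "(\<Sum>j\<in>{1..<N}. \<Sum>a<N. \<zeta> ^ (j * (a + (N - c))) * \<eta> a)
      = (\<Sum>j\<in>{1..<N}. gauss_sum p f (\<lambda>x. (\<zeta> ^ j) ^ dlog x) * \<zeta> ^ (j * (N - c)))"
    by (intro sum.cong refl)
       (simp add: g sum_distrib_left distrib_left power_add mult_ac)
  finally show ?thesis using tot sum_periods by simp
qed

section \<open>Divisibility by \<open>t\<close> and passage to the integers
  \<open>b a\<close>\<close>

text \<open>Every summand of the inversion formula is a Gauss sum times a root of unity.\<close>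

lemma alg_int_dvd_period:
  assumes "\<And>chi. C0_char chi \<Longrightarrow> alg_int_dvd P (gauss_sum p f chi)"
  shows "alg_int_dvd P (of_nat N * \<eta> c + 1)"
proof -
  define \<zeta> where "\<zeta> = cis (2 * pi / real N)"
  have N0: "N > 0" using N_gt_2 by simp
  have \<zeta>: "\<zeta> ^ k = 1 \<longleftrightarrow> N dvd k" for k
    unfolding \<zeta>_def by (rule cis_power_eq_1_iff[OF N0])
  have "\<exists>e. algebraic_int e \<and> gauss_sum p f (\<lambda>x. (\<zeta> ^ j) ^ dlog x) = P * e" if "j \<in> {1..<N}" for j
  proof -
    have "(\<zeta> ^ j) ^ N = 1" by (simp add: \<zeta> flip: power_mult)
    moreover have "\<zeta> ^ j \<noteq> 1" using that by (auto simp: \<zeta> dest: dvd_imp_le)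
    ultimately have "C0_char (\<lambda>x. (\<zeta> ^ j) ^ dlog x)" by (rule C0_char_dlog)
    then show ?thesis using assms unfolding alg_int_dvd_def by blast
  qed
  then obtain e where e: "\<And>j. j \<in> {1..<N} \<Longrightarrow> algebraic_int (e j)"
    "\<And>j. j \<in> {1..<N} \<Longrightarrow> gauss_sum p f (\<lambda>x. (\<zeta> ^ j) ^ dlog x) = P * e j"
    by metis
  define c' where "c' = c mod N"
  have "of_nat N * \<eta> c + 1 = of_nat N * \<eta> c' + 1" by (simp add: c'_def period_mod)
  also have "\<dots> = (\<Sum>j\<in>{1..<N}. gauss_sum p f (\<lambda>x. (\<zeta> ^ j) ^ dlog x) * \<zeta> ^ (j * (N - c')))"
    unfolding \<zeta>_def using N0 by (intro period_inversion) (simp add: c'_def)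
  also have "\<dots> = P * (\<Sum>j\<in>{1..<N}. e j * \<zeta> ^ (j * (N - c')))"
    by (simp add: e(2) sum_distrib_left mult.assoc)
  finally have "of_nat N * \<eta> c + 1 = P * (\<Sum>j\<in>{1..<N}. e j * \<zeta> ^ (j * (N - c')))" .
  moreover have "algebraic_int (\<Sum>j\<in>{1..<N}. e j * \<zeta> ^ (j * (N - c')))"
  proof (intro algebraic_int_sum algebraic_int_mult e(1))
    fix j
    have "(\<zeta> ^ (j * (N - c'))) ^ N = 1" by (simp add: \<zeta> flip: power_mult)
    then show "algebraic_int (\<zeta> ^ (j * (N - c')))" using N0 by (rule algebraic_int_root_of_unity)
  qed
  ultimately show ?thesis unfolding alg_int_dvd_def by blast
qed

text \<open>The powers of \<open>chi \<gamma>\<close> sum to \<open>0\<close>, so the constants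
  \<open>1\<close> and \<open>W\<close> disappear from the transform.\<close>

lemma gauss_sum_eq_combination:
  assumes chi: "C0_char chi" and b: "\<And>a. of_nat N * \<eta> a + 1 = T * (of_nat N * B a - W)"
  shows "gauss_sum p f chi = T * (\<Sum>a<N. chi \<gamma> ^ a * B a)"
proof -
  have z: "(\<Sum>a<N. chi \<gamma> ^ a) = 0"
    by (rule sum_root_of_unity_powers) (rule C0_char_root[OF chi])+
  have "of_nat N * gauss_sum p f chi = (\<Sum>a<N. chi \<gamma> ^ a * (of_nat N * \<eta> a + 1)) - (\<Sum>a<N. chi \<gamma> ^ a)"
    by (simp add: gauss_sum_eq[OF chi] sum_distrib_left sum.distrib algebra_simps)
  also have "\<dots> = (\<Sum>a<N. chi \<gamma> ^ a * (T * (of_nat N * B a - W)))" by (simp add: b z)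
  also have "\<dots> = of_nat N * (T * (\<Sum>a<N. chi \<gamma> ^ a * B a)) - T * W * (\<Sum>a<N. chi \<gamma> ^ a)"
    by (simp add: sum_distrib_left sum_subtractf algebra_simps)
  finally show ?thesis using z N_gt_2 by simp
qed

lemma algebraic_int_gauss_sum:
  assumes "C0_char chi"
  shows "algebraic_int (gauss_sum p f chi)"
proof -
  have "algebraic_int (chi \<gamma> ^ a)" for a
  proof -
    have "(chi \<gamma> ^ a) ^ N = 1"
      by (metis C0_char_root(1)[OF assms] mult.commute power_mult power_one)
    then show ?thesis using N_gt_2 by (intro algebraic_int_root_of_unity[of _ N]) auto
  qed
  then show ?thesis
    unfolding gauss_sum_eq[OF assms]
    by (intro algebraic_int_sum algebraic_int_mult algebraic_int_period)
qed

text \<open>The \<open>GREATEST\<close> in \<open>t_param\<close> is meaningful only if the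
  exponents are bounded. A nonzero integer \<open>N * \<eta> c + 1\<close>, divisible by every
  admissible \<open>p ^ k\<close>, supplies the bound.\<close>

lemma t_param_characterization:
  assumes int: "\<And>a. \<eta> a \<in> \<int>"
  obtains k where "t_param p f \<gamma> N = p ^ k"
    and "\<forall>chi. C0_char chi \<longrightarrow> alg_int_dvd (of_nat (p ^ k)) (gauss_sum p f chi)"
    and "\<not> (\<forall>chi. C0_char chi \<longrightarrow> alg_int_dvd (of_nat (p ^ Suc k)) (gauss_sum p f chi))"
proof -
  define D where "D k \<longleftrightarrow> (\<forall>chi. C0_char chi \<longrightarrow> alg_int_dvd (of_nat (p ^ k)) (gauss_sum p f chi))"
    for k
  have t: "t_param p f \<gamma> N = p ^ (GREATEST k. D k)"
    by (simp add: t_param_def D_def C0_char_def)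
  have D0: "D 0"
    using algebraic_int_gauss_sum by (auto simp: D_def alg_int_dvd_def)
  have "\<exists>c. of_nat N * \<eta> c + 1 \<noteq> 0"
  proof (rule ccontr)
    assume "\<not> (\<exists>c. of_nat N * \<eta> c + 1 \<noteq> 0)"
    then have "\<eta> c = - 1 / of_nat N" for c
      using N_gt_2 by (simp add: field_simps add_eq_0_iff)
    then have eq: "\<eta> c = \<eta> 0" for c by metis
    \<comment> \<open>Constant periods would have equal autocorrelations at shifts \<open>0\<close>
      and \<open>1\<close>, but these differ by \<open>q\<close>.\<close>
    have "(\<Sum>a<N. \<eta> a * cnj (\<eta> (a + 0))) = (\<Sum>a<N. \<eta> a * cnj (\<eta> (a + 1)))"
      using eq by (intro sum.cong refl) metis
    then show False
      using period_autocorrelation[of 0] period_autocorrelation[of 1] N_gt_2 p_gt_0 by simp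
  qed
  then obtain c where c: "of_nat N * \<eta> c + 1 \<noteq> 0" by blast
  obtain e where e: "\<eta> c = of_int e" using int[of c] by (auto elim: Ints_cases)
  define Y where "Y = int N * e + 1"
  have Y: "of_nat N * \<eta> c + 1 = of_int Y" by (simp add: Y_def e)
  have Y0: "Y \<noteq> 0" using c Y by auto
  have bound: "k \<le> nat \<bar>Y\<bar>" if "D k" for k
  proof -
    have "alg_int_dvd (of_nat (p ^ k)) (of_nat N * \<eta> c + 1)"
      using that by (intro alg_int_dvd_period) (simp add: D_def)
    then have "int (p ^ k) dvd Y"
      unfolding Y by (rule alg_int_dvd_of_int) (use p_gt_0 in simp)
    then have "p ^ k \<le> nat \<bar>Y\<bar>"
      using Y0 by (metis dvd_imp_le_int nat_int nat_mono abs_of_nat)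
    moreover have "k < p ^ k" using p_gt_1 by (simp add: power_gt_expt)
    ultimately show ?thesis by simp
  qed
  define k where "k = (GREATEST k. D k)"
  have "D k" unfolding k_def using GreatestI_nat[of D, OF D0 bound] .
  moreover have "\<not> D (Suc k)"
  proof
    assume "D (Suc k)"
    then have "Suc k \<le> k" unfolding k_def using Greatest_le_nat[of D, OF _ bound] by blast
    then show False by simp
  qed
  ultimately show thesis using t by (intro that[of k]) (auto simp: D_def k_def)
qed

lemma reduced_periods:
  assumes cop: "coprime N (p - 1)"
    and W: "[int (t_param p f \<gamma> N) * W = -1] (mod int N)"
  obtains b :: "nat \<Rightarrow> int"
  where "\<forall>a. of_nat N * \<eta> a + 1 = of_nat (t_param p f \<gamma> N) * (of_nat N * of_int (b a) - of_int W)"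
    and "(\<Sum>a<N. b a) = W"
    and "(int (t_param p f \<gamma> N))\<^sup>2 * (int N * (\<Sum>a<N. (b a)\<^sup>2) - W\<^sup>2) = (int N - 1) * int q"
    and "\<forall>d\<ge>2. \<exists>a<N. \<not> d dvd b a"
proof -
  have int: "\<eta> a \<in> \<int>" for a using period_in_Ints[OF cop] .
  obtain k where k: "t_param p f \<gamma> N = p ^ k"
    and k1: "\<forall>chi. C0_char chi \<longrightarrow> alg_int_dvd (of_nat (p ^ k)) (gauss_sum p f chi)"
    and k2: "\<not> (\<forall>chi. C0_char chi \<longrightarrow> alg_int_dvd (of_nat (p ^ Suc k)) (gauss_sum p f chi))"
    using t_param_characterization[OF int] .
  define t where "t = p ^ k"
  have t0: "t > 0" using p_gt_0 by (simp add: t_def)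
  have "\<forall>a. \<exists>i. \<eta> a = of_int i" using int by (auto elim: Ints_cases)
  then obtain e where e: "\<eta> a = of_int (e a)" for a by metis
  have "\<exists>x. int N * e a + 1 = int t * (int N * x - W)" for a
  proof -
    have "alg_int_dvd (of_nat t) (of_nat N * \<eta> a + 1)"
      unfolding t_def by (rule alg_int_dvd_period) (use k1 in blast)
    moreover have "of_nat N * \<eta> a + 1 = of_int (int N * e a + 1)" by (simp add: e)
    ultimately have "int t dvd int N * e a + 1"
      using t0 by (intro alg_int_dvd_of_int) simp_all
    then obtain y where y: "int N * e a + 1 = int t * y" by blast
    have W': "int N dvd int t * W + 1" using W by (simp add: k t_def cong_iff_dvd_diff)
    \<comment> \<open>Modulo \<open>N\<close> the product \<open>t * y\<close> is \<open>1\<close>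
      and \<open>t * W\<close> is \<open>-1\<close>; this is where condition (i) enters.\<close>
    have "int N dvd int t * (y + W)"
    proof -
      have "int t * (y + W) = int N * e a + (int t * W + 1)" using y by (simp add: algebra_simps)
      then show ?thesis using W' by simp
    qed
    moreover have "coprime (int N) (int t)"
      unfolding t_def using coprime_N_p by simp
    ultimately have "int N dvd y + W" by (simp add: coprime_dvd_mult_right_iff)
    then obtain x where "y + W = int N * x" by blast
    then have "y = int N * x - W" by simp
    then show ?thesis using y by blast
  qed
  then obtain b where b: "int N * e a + 1 = int t * (int N * b a - W)" for a by metis
  have b\<eta>: "of_nat N * \<eta> a + 1 = of_nat t * (of_nat N * of_int (b a) - of_int W)" for a
  proof -
    have "of_nat N * \<eta> a + 1 = of_int (int N * e a + 1)" by (simp add: e)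
    then show ?thesis unfolding b by simp
  qed
  have b_shift: "(\<Sum>a<N. b (a + c)) = (\<Sum>a<N. b a)" for c
  proof (rule sum_lessThan_shift_periodic)
    fix i
    have "\<eta> (i + N) = \<eta> i" using period_add_mult[of i 1] by simp
    then have "e (i + N) = e i" by (simp add: e)
    then have "int t * (int N * b (i + N) - W) = int t * (int N * b i - W)" using b by metis
    then show "b (i + N) = b i" using t0 N_gt_2 by simp
  qed
  have sum_e: "(\<Sum>a<N. e a) = -1"
  proof -
    have "complex_of_int (\<Sum>a<N. e a) = of_int (-1)" using sum_periods by (simp add: e)
    then show ?thesis by (simp only: of_int_eq_iff)
  qed
  have sum_b: "(\<Sum>a<N. b a) = W"
  proof -
    have "(\<Sum>a<N. int N * e a + 1) = 0"
      by (simp add: sum.distrib sum_e flip: sum_distrib_left)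
    moreover have "(\<Sum>a<N. int N * e a + 1) = int t * int N * ((\<Sum>a<N. b a) - W)"
      unfolding b by (simp add: sum_distrib_left sum_subtractf algebra_simps)
    ultimately show ?thesis using t0 N_gt_2 by simp
  qed
  have e_shift: "(\<Sum>a<N. e (a + c)) = -1" for c
  proof -
    have "int N * (\<Sum>a<N. e (a + c)) + int N = (\<Sum>a<N. int N * e (a + c) + 1)"
      by (simp add: sum.distrib sum_distrib_left)
    also have "\<dots> = int t * int N * ((\<Sum>a<N. b (a + c)) - W)"
      unfolding b by (simp add: sum_distrib_left sum_subtractf algebra_simps)
    also have "\<dots> = 0" by (simp add: b_shift sum_b)
    finally have "int N * ((\<Sum>a<N. e (a + c)) + 1) = 0" by (simp add: algebra_simps)
    then show ?thesis using N_gt_2 by simp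
  qed
  \<comment> \<open>The autocorrelation of \<open>N * e a + 1\<close> is evaluated twice, through
    the periods and through \<open>b\<close>.\<close>
  have corr: "(int t)\<^sup>2 * (int N * (\<Sum>a<N. b a * b (a + c)) - W\<^sup>2)
      = (if c = 0 then int N * int q else 0) - int q" if c: "c < N" for c
  proof -
    have "complex_of_int (\<Sum>a<N. e a * e (a + c)) = of_int ((if c = 0 then int q else 0) - int K)"
      using period_autocorrelation[OF c] by (simp add: e)
    then have ee: "(\<Sum>a<N. e a * e (a + c)) = (if c = 0 then int q else 0) - int K"
      by (simp only: of_int_eq_iff)
    have NK: "int N * int K = int q - 1"
    proof -
      have "int N * int K = int (q - 1)" using N_K by (simp flip: of_nat_mult)
      then show ?thesis using p_gt_0 by simp
    qed
    have "(\<Sum>a<N. (int N * e a + 1) * (int N * e (a + c) + 1))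
        = int N * (int N * (\<Sum>a<N. e a * e (a + c)) + (\<Sum>a<N. e a) + (\<Sum>a<N. e (a + c)) + 1)"
      by (simp add: sum_distrib_left sum.distrib algebra_simps)
    also have "\<dots> = int N * (int N * (if c = 0 then int q else 0) - int N * int K - 1)"
      by (simp add: ee sum_e e_shift algebra_simps)
    also have "\<dots> = int N * ((if c = 0 then int N * int q else 0) - int q)"
      by (simp add: NK)
    finally have 1: "(\<Sum>a<N. (int N * e a + 1) * (int N * e (a + c) + 1))
        = int N * ((if c = 0 then int N * int q else 0) - int q)" .
    have "(\<Sum>a<N. (int N * e a + 1) * (int N * e (a + c) + 1))
        = (int t)\<^sup>2 * int N * (int N * (\<Sum>a<N. b a * b (a + c))
            - W * (\<Sum>a<N. b a) - W * (\<Sum>a<N. b (a + c)) + W\<^sup>2)"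
      unfolding b
      by (simp add: sum_distrib_left sum.distrib sum_subtractf power2_eq_square algebra_simps)
    also have "\<dots> = int N * ((int t)\<^sup>2 * (int N * (\<Sum>a<N. b a * b (a + c)) - W\<^sup>2))"
      by (simp add: b_shift sum_b power2_eq_square algebra_simps)
    finally have 2: "(\<Sum>a<N. (int N * e a + 1) * (int N * e (a + c) + 1))
        = int N * ((int t)\<^sup>2 * (int N * (\<Sum>a<N. b a * b (a + c)) - W\<^sup>2))" .
    have "int N \<noteq> 0" using N_gt_2 by simp
    then show ?thesis using trans[OF 2[symmetric] 1] by (simp only: mult_cancel_left) simp
  qed
  have sq: "(int t)\<^sup>2 * (int N * (\<Sum>a<N. (b a)\<^sup>2) - W\<^sup>2) = (int N - 1) * int q"
    using corr[of 0] N_gt_2 by (simp add: power2_eq_square algebra_simps)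
  \<comment> \<open>Subtracting the correlation at shift \<open>1\<close> from that at shift
    \<open>0\<close> cancels \<open>W\<^sup>2\<close>.\<close>
  have q_eq: "int q = (int t)\<^sup>2 * (\<Sum>a<N. b a * (b a - b (a + 1)))"
  proof -
    have "int N * int q = int N * ((int t)\<^sup>2 * ((\<Sum>a<N. b a * b a) - (\<Sum>a<N. b a * b (a + 1))))"
      using corr[of 0] corr[of 1] N_gt_2 by (simp add: algebra_simps)
    then have "int q = (int t)\<^sup>2 * ((\<Sum>a<N. b a * b a) - (\<Sum>a<N. b a * b (a + 1)))"
      using N_gt_2 by (simp only: mult_cancel_left) simp
    then show ?thesis by (simp add: sum_subtractf right_diff_distrib)
  qed
  have prim: "\<exists>a<N. \<not> d dvd b a" if d: "d \<ge> 2" for d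
  proof (rule ccontr)
    assume "\<not> (\<exists>a<N. \<not> d dvd b a)"
    then have dvd: "d dvd b a" if "a < N" for a using that by auto
    \<comment> \<open>The factor \<open>b a\<close> with \<open>a < N\<close> suffices, so the index
      \<open>a + 1\<close> may leave the range.\<close>
    have "d dvd int q" unfolding q_eq by (intro dvd_mult dvd_sum dvd_mult2 dvd) simp
    then have "nat d dvd p ^ f" using d by (simp add: nat_dvd_iff)
    then obtain l where l: "nat d = p ^ l" using prime_p by (auto simp: divides_primepow_nat)
    then have "l > 0" using d by (cases l) auto
    then have "p dvd nat d" unfolding l by simp
    then have "int p dvd int (nat d)" by (simp only: of_nat_dvd_iff)
    then have "int p dvd d" using d by simp
    then have "\<forall>a\<in>{..<N}. \<exists>x. b a = int p * x" using dvd by (meson dvdE dvd_trans lessThan_iff)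
    then obtain b' where b': "\<And>a. a < N \<Longrightarrow> b a = int p * b' a" by (metis lessThan_iff)
    have "alg_int_dvd (of_nat (p ^ Suc k)) (gauss_sum p f chi)" if chi: "C0_char chi" for chi
    proof -
      have "gauss_sum p f chi = of_nat t * (\<Sum>a<N. chi \<gamma> ^ a * of_int (b a))"
        by (rule gauss_sum_eq_combination[OF chi b\<eta>])
      also have "(\<Sum>a<N. chi \<gamma> ^ a * of_int (b a)) = of_nat p * (\<Sum>a<N. chi \<gamma> ^ a * of_int (b' a))"
        by (simp add: b' sum_distrib_left mult_ac)
      finally have "gauss_sum p f chi = of_nat (p ^ Suc k) * (\<Sum>a<N. chi \<gamma> ^ a * of_int (b' a))"
        by (simp add: t_def)
      moreover have "algebraic_int (\<Sum>a<N. chi \<gamma> ^ a * of_int (b' a))"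
      proof (intro algebraic_int_sum algebraic_int_mult)
        fix a
        have "(chi \<gamma> ^ a) ^ N = 1"
          by (metis C0_char_root(1)[OF chi] mult.commute power_mult power_one)
        then show "algebraic_int (chi \<gamma> ^ a)"
          using N_gt_2 by (intro algebraic_int_root_of_unity[of _ N]) auto
      qed (simp add: int_imp_algebraic_int)
      ultimately show ?thesis unfolding alg_int_dvd_def by blast
    qed
    then show False using k2 by blast
  qed
  show thesis
    by (rule that[of b]) (use b\<eta> sum_b sq prim in \<open>simp_all add: k flip: t_def\<close>)
qed

end

section \<open>Power sums, orbit counts and the return from \<open>b\<close> to the periods\<close>

theorem theorem3p4:
  fixes \<gamma> :: "'a::{finite,field}" and p f N q :: nat and u v r s :: int and m :: nat
  assumes "prime p" and "f > 0" and "q = p ^ f" and "CARD('a) = q"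
    and "(of_nat p :: 'a) = 0"
    and "N > 2" and "N dvd (q - 1)"
    and "primitive_elem \<gamma>"
    and "u > 0" "v > 0" "r > 0" "s > 0"
    and "[int (t_param p f \<gamma> N) * (- u * r + v * s) = -1] (mod int N)"
    and "(int N - 1) * int q + (int (t_param p f \<gamma> N))^2 * (- u * r + v * s)^2
           = int N * (int (t_param p f \<gamma> N))^2 * (u^2 * r + v^2 * s)"
    and "m = Gcd {ord n p | n. n > 1 \<and> n dvd N}"
    and "m \<ge> 2"
    and "(u = 1 \<and> s = 1 \<and> v * (v + 1) < 2 * int m \<and> r + 1 < int N)
       \<or> (u = 1 \<and> s = 1 \<and> v * (v + 1) = 2 * int m \<and> r + v^2 < int N)
       \<or> (v = 1 \<and> r = 1 \<and> u * (u + 1) < 2 * int m \<and> s + 1 < int N)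
       \<or> (v = 1 \<and> r = 1 \<and> u * (u + 1) = 2 * int m \<and> s + u^2 < int N)
       \<or> (u = 1 \<and> v = 1 \<and> s = int m \<and> r + int m < int N)
       \<or> (u = 1 \<and> v = 1 \<and> r = int m \<and> s + int m < int N)"
  shows "card (gauss_period p f \<gamma> N ` {0..<N}) = 3"
proof -
  interpret gauss_periods p f "TYPE('a)" \<gamma> N
    by unfold_locales (use assms in auto)
  have m_dvd: "m dvd ord n p" if "n > 1" "n dvd N" for n
    unfolding assms(15) by (rule Gcd_dvd) (use that in blast)
  \<comment> \<open>A common prime \<open>l\<close> would give \<open>ord l p = 1\<close>, so
    \<open>m\<close> would divide \<open>1\<close>.\<close>
  have cop: "coprime N (p - 1)"
  proof (rule ccontr)
    assume "\<not> coprime N (p - 1)"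
    then have "gcd N (p - 1) \<noteq> 1" unfolding coprime_iff_gcd_eq_1 .
    from prime_factor_nat[OF this] obtain l where l': "prime l" "l dvd gcd N (p - 1)" by blast
    have l: "prime l" "l dvd N" "l dvd p - 1"
      using l' by (simp_all only: gcd_greatest_iff)
    have "[p = 1] (mod l)" using l(3) p_gt_0 by (simp add: cong_altdef_nat)
    then have "ord l p = 1" by (simp add: ord_eq_Suc_0_iff)
    then have "m dvd 1" using m_dvd[OF prime_gt_1_nat[OF l(1)] l(2)] by simp
    then show False using assms(16) by simp
  qed
  obtain b where b': "\<forall>a. of_nat N * \<eta> a + 1
        = of_nat (t_param p f \<gamma> N) * (of_nat N * of_int (b a) - of_int (- u * r + v * s))"
    and sum1: "(\<Sum>a<N. b a) = - u * r + v * s"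
    and sq: "(int (t_param p f \<gamma> N))\<^sup>2 * (int N * (\<Sum>a<N. (b a)\<^sup>2) - (- u * r + v * s)\<^sup>2)
        = (int N - 1) * int (p ^ f)"
    and prim: "\<forall>d\<ge>2. \<exists>a<N. \<not> d dvd b a"
    using reduced_periods[OF cop assms(13)] .
  note b = b'[rule_format]
  define t where "t = t_param p f \<gamma> N"
  have t0: "t > 0" unfolding t_def t_param_def using p_gt_0 by simp
  have N0: "N > 0" using assms(6) by simp
  \<comment> \<open>Condition (ii) and \<open>sq\<close> give the same value for
    \<open>N * t\<^sup>2\<close> times the two sides.\<close>
  have sum2: "(\<Sum>a<N. (b a)\<^sup>2) = u\<^sup>2 * r + v\<^sup>2 * s"
  proof -
    define W where "W = - u * r + v * s"
    have "int N * (int t)\<^sup>2 * (\<Sum>a<N. (b a)\<^sup>2)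
        = (int t)\<^sup>2 * (int N * (\<Sum>a<N. (b a)\<^sup>2) - W\<^sup>2) + (int t)\<^sup>2 * W\<^sup>2"
      by (simp add: right_diff_distrib mult_ac)
    also have "\<dots> = int N * (int t)\<^sup>2 * (u\<^sup>2 * r + v\<^sup>2 * s)"
      unfolding t_def W_def sq using assms(14) by (simp only: assms(3))
    finally have "int N * (int t)\<^sup>2 * (\<Sum>a<N. (b a)\<^sup>2) = int N * (int t)\<^sup>2 * (u\<^sup>2 * r + v\<^sup>2 * s)" .
    then show ?thesis using t0 N0 by simp
  qed
  have inj: "\<eta> a = \<eta> a' \<longleftrightarrow> b a = b a'" for a a'
  proof -
    have "\<eta> a = \<eta> a' \<longleftrightarrow> of_nat N * \<eta> a + 1 = of_nat N * \<eta> a' + 1" using N0 by simp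
    also have "\<dots> \<longleftrightarrow> b a = b a'" unfolding b using t0 N0 by (simp add: t_def)
    finally show ?thesis .
  qed
  \<comment> \<open>Frobenius invariance makes each level set of \<open>b\<close> stable under
    multiplication by \<open>p\<close>, which keeps nonzero residues nonzero.\<close>
  have cnt: "m dvd card {a \<in> {1..<N}. b a = c}" for c
  proof (rule dvd_card_mult_invariant_subset[OF coprime_N_p])
    show "m dvd ord n p" if "n > 1" "n dvd N" for n using m_dvd that .
    show "{a \<in> {1..<N}. b a = c} \<subseteq> {1..<N}" by blast
    fix a assume a: "a \<in> {a \<in> {1..<N}. b a = c}"
    have "\<eta> (a * p mod N) = \<eta> a" by (simp add: period_mod period_frobenius)
    then have "b (a * p mod N) = c" using inj a by simp
    moreover have "a * p mod N \<noteq> 0"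
    proof
      assume "a * p mod N = 0"
      then have "N dvd a" using coprime_N_p by (auto simp: coprime_dvd_mult_left_iff)
      then show False using a by (auto dest: dvd_imp_le)
    qed
    ultimately show "a * p mod N \<in> {a \<in> {1..<N}. b a = c}" using N0 by simp
  qed
  have "card (b ` {..<N}) = 3"
    by (rule three_values_if_power_sums[OF N0 assms(16) cnt prim[rule_format] assms(9-12) sum1 sum2 assms(17)])
  moreover have "card (\<eta> ` {..<N}) = card (b ` {..<N})"
  proof -
    \<comment> \<open>This affine map recovers the period from \<open>b a\<close>; its slope is
      \<open>t\<close>, so it is injective.\<close>
    define h :: "int \<Rightarrow> complex" where "h x = (of_nat t * (of_nat N * of_int x - of_int (- u * r + v * s)) - 1) / of_nat N"
      for x
    have "\<eta> a = h (b a)" for a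
      unfolding h_def t_def b [symmetric] using N0 by simp
    then have "\<eta> ` {..<N} = h ` (b ` {..<N})" by auto
    moreover have "inj_on h (b ` {..<N})"
      using t0 N0 by (auto simp: h_def inj_on_def)
    ultimately show ?thesis by (simp add: card_image)
  qed
  ultimately show ?thesis by (simp add: lessThan_atLeast0)
qed

end
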